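(* Let $n\ge 5$, let $\mathfrak g=\mathfrak{so}(2n,\mathbb C)$ and let $\mathfrak q=\mathfrak l\oplus\mathfrak n$ be the maximal parabolic subalgebra determined by the simple root $\alpha_{n-2}$ (type $D_n(n-2)$). Let $\mu=\varepsilon_1+\varepsilon_{n-1}$ (the highest weight of $\mathfrak g(1)$), and let $\epsilon$ be one of $\epsilon_\gamma=\varepsilon_1-\varepsilon_{n-1}$, $\epsilon^+_{n\gamma}=\varepsilon_2+\varepsilon_n$, $\epsilon^-_{n\gamma}=\varepsilon_2-\varepsilon_n$, so that $V(\mu+\epsilon)$ is one of the irreducible $\mathfrak l$-constituents $V(2\varepsilon_1)$, $V(\varepsilon_1+\varepsilon_2+\varepsilon_{n-1}+\varepsilon_n)$, $V(\varepsilon_1+\varepsilon_2+\varepsilon_{n-1}-\varepsilon_n)$ of $\mathfrak l\otimes\mathfrak z(\mathfrak n)$. Then the $\Omega_2|_{V(\mu+\epsilon)^*}$ system is conformally invariant on $\mathcal L_s$ if and only if $$ s=\frac{|\Delta_{\mu+\epsilon}(\mathfrak g(1))|}{2}-1, $$ where $\Delta_{\nu}(\mathfrak g(1))=\{\alpha\in\Delta(\mathfrak g(1)) : \nu-\alpha\in\Delta\}$ and $|\cdot|$ denotes cardinality.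
   Context: General setting. $\mathfrak g$ is a complex simple Lie algebra with Cartan subalgebra $\mathfrak h$, root system $\Delta$, positive system $\Delta^+$, simple roots $\Pi=\{\alpha_1,\dots,\alpha_n\}$ (Bourbaki labelling), Killing form $\kappa$, and $\rho$ half the sum of positive roots; for $\alpha\in\Delta$ fix root vectors $X_\alpha$. For a subspace $W\subset\mathfrak g$, $\Delta(W)$ is the set of roots whose root spaces lie in $W$. For a simple root $\alpha_{\mathfrak q}$, $\mathfrak q=\mathfrak l\oplus\mathfrak n$ is the standard maximal parabolic subalgebra with $\mathfrak l=\mathfrak h\oplus\bigoplus\{\mathfrak g_\alpha:\alpha\in\Delta\cap\mathrm{span}(\Pi\setminus\{\alpha_{\mathfrak q}\})\}$ and $\mathfrak n$ the sum of the remaining positive root spaces; $\lambda_{\mathfrak q}$ is the fundamental weight of $\alpha_{\mathfrak q}$. In the case at hand $\mathfrak n$ is two-step nilpotent and the eigenspaces of $\mathrm{ad}(H_{\mathfrak q})$, where $\beta(H_{\mathfrak q})=2\langle\lambda_{\mathfrak q},\beta\rangle/\|\alpha_{\mathfrak q}\|^2$, give a grading $\mathfrak g=\bigoplus_{j=-2}^2\mathfrak g(j)$ with $\mathfrak l=\mathfrak g(0)$, $\mathfrak n=\mathfrak g(1)\oplus\mathfrak g(2)$, $\mathfrak z(\mathfrak n)=\mathfrak g(2)$, $\bar{\mathfrak n}=\mathfrak g(-1)\oplus\mathfrak g(-2)$, $\mathfrak z(\bar{\mathfrak n})=\mathfrak g(-2)$. $V(\nu)$ denotes the simple $\mathfrak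 l$-module of highest weight $\nu$. Construction. Let $\omega=\sum_{\gamma_j\in\Delta(\mathfrak z(\mathfrak n))}X^*_{\gamma_j}\otimes X_{\gamma_j}$, where $X^*_{\gamma_j}\in\mathfrak g_{-\gamma_j}$ satisfies $\kappa(X^*_{\gamma_j},X_{\gamma_t})=\delta_{jt}$, and $\tau_2:\mathfrak g(1)\to\mathfrak l\otimes\mathfrak z(\mathfrak n)$, $\tau_2(X)=\tfrac12(\mathrm{ad}(X)^2\otimes\mathrm{Id})\omega$. For an irreducible $\mathfrak l$-constituent $W$ of $\mathfrak l\otimes\mathfrak z(\mathfrak n)$, realize its dual $W^*$ inside $\mathfrak l\otimes\mathfrak z(\bar{\mathfrak n})$ via $\kappa$ (with $(A\otimes B)(C\otimes D)=\kappa(A,C)\kappa(B,D)$) and define $\tilde\tau_2|_{W^*}:W^*\to\mathcal P^2(\mathfrak g(1))$ by $\tilde\tau_2(Y^* )(X)=Y^*(\tau_2(X))$. Identifying $\mathcal P^2(\mathfrak g(1))\cong\mathrm{Sym}^2(\mathfrak g(-1))$ via $\kappa$ and letting $\sigma:\mathrm{Sym}^2(\mathfrak g(-1))\to\mathcal U(\bar{\mathfrak n})$ be symmetrization, put $\omega_2|_{W^*}=\sigma\circ\tilde\tau_2|_{W^*}$. The $\Omega_2|_{W^*}$ system is the system of differential operators $R(\omega_2(Y^* ))$, $Y^*$ running over a basis of $W^*$, acting on sections of the line bundle $\mathcal L_s$ ($s\in\mathbb C$) over $\bar N_0$ (the restriction to the open cell $\bar N_0Q_0/Q_0$ of the line bundle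 on $G_0/Q_0$ induced by the character $|\chi_{\mathfrak q}|^s$ of $Q_0$ with differential $s\lambda_{\mathfrak q}$), $R$ the infinitesimal right translation. Let $\mathbb C_{-s}$ be the one-dimensional $\mathfrak q$-module with $\mathfrak h$ acting by $-s\lambda_{\mathfrak q}$ and $[\mathfrak l,\mathfrak l]+\mathfrak n$ acting by $0$, $M_{\mathfrak q}[\mathbb C_{-s}]=\mathcal U(\mathfrak g)\otimes_{\mathcal U(\mathfrak q)}\mathbb C_{-s}$ with generator $1_{-s}$. By a theorem of Barchini–Kable–Zierau (which may be taken as the definition here), the $\Omega_2|_{W^*}$ system is conformally invariant on $\mathcal L_s$ if and only if $X\cdot(\omega_2(Y^* )\otimes 1_{-s})=0$ in $M_{\mathfrak q}[\mathbb C_{-s}]$ for all $X\in\mathfrak n$ and $Y^*\in W^*$. Type $D_n$ data: roots $\pm\varepsilon_j\pm\varepsilon_k$ ($j<k$), $\alpha_j=\varepsilon_j-\varepsilon_{j+1}$ ($j<n$), $\alpha_n=\varepsilon_{n-1}+\varepsilon_n$; here $\alpha_{\mathfrak q}=\alpha_{n-2}$, $\Delta(\mathfrak g(1))=\{\varepsilon_j\pm\varepsilon_k: 1\le j\le n-2,\ k\in\{n-1,n\}\}$, $\Delta(\mathfrak z(\mathfrak n))=\{\varepsilon_j+\varepsilon_k:1\le j<k\le n-2\}$. *)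

theory Defs
  imports Complex_Main
begin

text \<open>Concrete model of so(2n,C), type D_n(n-2). Matrices are functions
  nat => nat => complex, vanishing outside the index range 0..2n-1 (0-based).
  The weight epsilon_k (1-based) corresponds to matrix index k-1.\<close>

type_synonym cmat = "nat \<Rightarrow> nat \<Rightarrow> complex"
type_synonym arr4 = "nat \<Rightarrow> nat \<Rightarrow> nat \<Rightarrow> nat \<Rightarrow> complex"
type_synonym fvec = "cmat list \<Rightarrow> complex"   \<comment> \<open>free vector space on words of letters in g\<close>
type_synonym wt = "nat \<Rightarrow> int"                  \<comment> \<open>weights, coefficients w.r.t. eps_1..eps_n\<close>

definition Emat :: "nat \<Rightarrow> nat \<Rightarrow> cmat" where
  "Emat i j = (\<lambda>a b. if a = i \<and> b = j then 1 else 0)"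

definition mmul :: "nat \<Rightarrow> cmat \<Rightarrow> cmat \<Rightarrow> cmat" where
  "mmul n A B = (\<lambda>i j. \<Sum>k<2*n. A i k * B k j)"

definition brk :: "nat \<Rightarrow> cmat \<Rightarrow> cmat \<Rightarrow> cmat" where
  "brk n A B = (\<lambda>i j. mmul n A B i j - mmul n B A i j)"

definition msc :: "complex \<Rightarrow> cmat \<Rightarrow> cmat" where
  "msc c A = (\<lambda>i j. c * A i j)"

definition mtr :: "nat \<Rightarrow> cmat \<Rightarrow> complex" where
  "mtr n A = (\<Sum>i<2*n. A i i)"

text \<open>Killing form of so(2n): kappa(X,Y) = (2n-2) tr(XY).\<close>
definition kappa :: "nat \<Rightarrow> cmat \<Rightarrow> cmat \<Rightarrow> complex" where
  "kappa n A B = of_nat (2*n-2) * mtr n (mmul n A B)"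

definition Jmat :: "nat \<Rightarrow> cmat" where
  "Jmat n = (\<lambda>a b. if a < 2*n \<and> b < 2*n \<and> (a + n = b \<or> b + n = a) then 1 else 0)"

definition so :: "nat \<Rightarrow> cmat set" where
  "so n = {A. (\<forall>i j. (2*n \<le> i \<or> 2*n \<le> j) \<longrightarrow> A i j = 0) \<and>
              (\<forall>i<2*n. \<forall>j<2*n. mmul n (\<lambda>a b. A b a) (Jmat n) i j + mmul n (Jmat n) A i j = 0)}"

text \<open>Eigenvalues of the grading element H_q = diag(1,..,1,0,0,-1,..,-1,0,0)
  (ad H_q has eigenvalue hq a - hq b on the matrix entry (a,b)).\<close>
definition hq :: "nat \<Rightarrow> nat \<Rightarrow> int" where
  "hq n a = (if a < n-2 then 1 else if a < n then 0 else if a < 2*n-2 then -1 else 0)"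

definition gpart :: "nat \<Rightarrow> (int \<Rightarrow> bool) \<Rightarrow> cmat set" where
  "gpart n P = {A \<in> so n. \<forall>a b. A a b \<noteq> 0 \<longrightarrow> P (hq n a - hq n b)}"

definition lev :: "nat \<Rightarrow> cmat set" where "lev n = gpart n (\<lambda>d. d = 0)"
definition nrad :: "nat \<Rightarrow> cmat set" where "nrad n = gpart n (\<lambda>d. d > 0)"
definition qpar :: "nat \<Rightarrow> cmat set" where "qpar n = gpart n (\<lambda>d. d \<ge> 0)"
definition zbar :: "nat \<Rightarrow> cmat set" where "zbar n = gpart n (\<lambda>d. d = -2)"

definition cartan :: "nat \<Rightarrow> cmat set" where
  "cartan n = {A \<in> so n. \<forall>a b. a \<noteq> b \<longrightarrow> A a b = 0}"

text \<open>Root vectors (0-based indices i,j < n): roots eps_i - eps_j, eps_i + eps_j, -eps_i - eps_j.\<close>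
definition rv_minus :: "nat \<Rightarrow> nat \<Rightarrow> nat \<Rightarrow> cmat" where
  "rv_minus n i j = (\<lambda>a b. Emat i j a b - Emat (n+j) (n+i) a b)"
definition rv_pp :: "nat \<Rightarrow> nat \<Rightarrow> nat \<Rightarrow> cmat" where
  "rv_pp n i j = (\<lambda>a b. Emat i (n+j) a b - Emat j (n+i) a b)"
definition rv_mm :: "nat \<Rightarrow> nat \<Rightarrow> nat \<Rightarrow> cmat" where
  "rv_mm n i j = (\<lambda>a b. Emat (n+j) i a b - Emat (n+i) j a b)"

text \<open>Basis of g(1): roots eps_j +- eps_k, j < n-2, k in {n-2,n-1} (0-based); dual basis in g(-1).\<close>
definition g1idx :: "nat \<Rightarrow> (nat \<times> nat \<times> bool) set" where
  "g1idx n = {(j,k,b). j < n-2 \<and> (k = n-2 \<or> k = n-1)}"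
fun e1 :: "nat \<Rightarrow> nat \<times> nat \<times> bool \<Rightarrow> cmat" where
  "e1 n (j,k,b) = (if b then rv_pp n j k else rv_minus n j k)"
fun e1neg :: "nat \<Rightarrow> nat \<times> nat \<times> bool \<Rightarrow> cmat" where
  "e1neg n (j,k,b) = (if b then rv_mm n j k else rv_minus n k j)"
definition e1dual :: "nat \<Rightarrow> nat \<times> nat \<times> bool \<Rightarrow> cmat" where
  "e1dual n \<beta> = msc (1 / kappa n (e1neg n \<beta>) (e1 n \<beta>)) (e1neg n \<beta>)"

text \<open>Delta(z(n)) = {eps_j + eps_k : j < k < n-2} (0-based), and X^*_gamma.\<close>
definition zidx :: "nat \<Rightarrow> (nat \<times> nat) set" where
  "zidx n = {(j,k). j < k \<and> k < n-2}"
fun zdual :: "nat \<Rightarrow> nat \<times> nat \<Rightarrow> cmat" where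
  "zdual n (j,k) = msc (1 / kappa n (rv_mm n j k) (rv_pp n j k)) (rv_mm n j k)"

text \<open>Tensors of two matrix spaces modelled as 4-index arrays (Kronecker products).\<close>
definition kron :: "cmat \<Rightarrow> cmat \<Rightarrow> arr4" where
  "kron C D = (\<lambda>a b c d. C a b * D c d)"

text \<open>tau_2(X) = 1/2 (ad(X)^2 (x) Id) omega.\<close>
definition tau2 :: "nat \<Rightarrow> cmat \<Rightarrow> arr4" where
  "tau2 n X = (\<lambda>a b c d. (1/2) * (\<Sum>\<gamma>\<in>zidx n.
      kron (brk n X (brk n X (zdual n \<gamma>))) (rv_pp n (fst \<gamma>) (snd \<gamma>)) a b c d))"

text \<open>(A (x) B)(C (x) D) = kappa(A,C) kappa(B,D).\<close>
definition pairing :: "nat \<Rightarrow> arr4 \<Rightarrow> arr4 \<Rightarrow> complex" where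
  "pairing n T T' = (of_nat (2*n-2))^2 *
     (\<Sum>a<2*n. \<Sum>b<2*n. \<Sum>c<2*n. \<Sum>d<2*n. T a b c d * T' b a d c)"

definition polyY :: "nat \<Rightarrow> arr4 \<Rightarrow> cmat \<Rightarrow> complex" where
  "polyY n Y X = pairing n Y (tau2 n X)"
definition polarB :: "nat \<Rightarrow> arr4 \<Rightarrow> cmat \<Rightarrow> cmat \<Rightarrow> complex" where
  "polarB n Y X X' = (polyY n Y (\<lambda>a b. X a b + X' a b) - polyY n Y X - polyY n Y X') / 2"

definition wd :: "cmat list \<Rightarrow> fvec" where
  "wd w = (\<lambda>v. if v = w then 1 else 0)"

text \<open>omega_2(Y*) = sigma(tilde tau_2(Y*)), lifted to the tensor algebra; the polynomial
  sum c_{b b'} x_b x_b' (c symmetric) corresponds to sum c_{b b'} X*_b X*_b' in Sym^2(g(-1)),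
  whose symmetrization is the word sum below.\<close>
definition omega2 :: "nat \<Rightarrow> arr4 \<Rightarrow> fvec" where
  "omega2 n Y = (\<lambda>v. \<Sum>\<beta>\<in>g1idx n. \<Sum>\<beta>'\<in>g1idx n.
      polarB n Y (e1 n \<beta>) (e1 n \<beta>') * wd [e1dual n \<beta>, e1dual n \<beta>'] v)"

definition lmul :: "cmat \<Rightarrow> fvec \<Rightarrow> fvec" where
  "lmul X f = (\<lambda>v. case v of [] \<Rightarrow> 0 | x # w \<Rightarrow> (if x = X then f w else 0))"

text \<open>The character of q on C_{-s}: h acts by -s lambda_q, [l,l]+n by 0.\<close>
definition chi :: "nat \<Rightarrow> complex \<Rightarrow> cmat \<Rightarrow> complex" where
  "chi n s z = - s * (\<Sum>k<n-2. z k k)"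

text \<open>Kernel of the map from the free vector space on words in g onto
  M_q[C_{-s}] = U(g) (x)_{U(q)} C_{-s}: multilinearity relations (giving T(g)),
  the two-sided ideal of U(g), and the left ideal generated by z - chi(z), z in q.\<close>
inductive_set Kid :: "nat \<Rightarrow> complex \<Rightarrow> fvec set" for n :: nat and s :: complex where
  zero: "(\<lambda>v. 0) \<in> Kid n s"
| add: "f \<in> Kid n s \<Longrightarrow> h \<in> Kid n s \<Longrightarrow> (\<lambda>v. f v + h v) \<in> Kid n s"
| scl: "f \<in> Kid n s \<Longrightarrow> (\<lambda>v. c * f v) \<in> Kid n s"
| lin_add: "set u \<subseteq> so n \<Longrightarrow> set w \<subseteq> so n \<Longrightarrow> x \<in> so n \<Longrightarrow> y \<in> so n \<Longrightarrow>
     (\<lambda>v. wd (u @ [\<lambda>a b. x a b + y a b] @ w) v - wd (u @ [x] @ w) v - wd (u @ [y] @ w) v) \<in> Kid n s"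
| lin_scl: "set u \<subseteq> so n \<Longrightarrow> set w \<subseteq> so n \<Longrightarrow> x \<in> so n \<Longrightarrow>
     (\<lambda>v. wd (u @ [msc c x] @ w) v - c * wd (u @ [x] @ w) v) \<in> Kid n s"
| comm: "set u \<subseteq> so n \<Longrightarrow> set w \<subseteq> so n \<Longrightarrow> x \<in> so n \<Longrightarrow> y \<in> so n \<Longrightarrow>
     (\<lambda>v. wd (u @ [x, y] @ w) v - wd (u @ [y, x] @ w) v - wd (u @ [brk n x y] @ w) v) \<in> Kid n s"
| par: "set u \<subseteq> so n \<Longrightarrow> z \<in> qpar n \<Longrightarrow>
     (\<lambda>v. wd (u @ [z]) v - chi n s z * wd u v) \<in> Kid n s"

inductive_set LZbar :: "nat \<Rightarrow> arr4 set" for n :: nat where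
  gen: "C \<in> lev n \<Longrightarrow> D \<in> zbar n \<Longrightarrow> kron C D \<in> LZbar n"
| zero: "(\<lambda>a b c d. 0) \<in> LZbar n"
| add: "T \<in> LZbar n \<Longrightarrow> T' \<in> LZbar n \<Longrightarrow> (\<lambda>a b c d. T a b c d + T' a b c d) \<in> LZbar n"
| scl: "T \<in> LZbar n \<Longrightarrow> (\<lambda>a b c d. k * T a b c d) \<in> LZbar n"

text \<open>Adjoint action of Z on tensors: Z.(C (x) D) = [Z,C] (x) D + C (x) [Z,D].\<close>
definition act4 :: "nat \<Rightarrow> cmat \<Rightarrow> arr4 \<Rightarrow> arr4" where
  "act4 n Z T = (\<lambda>a b c d. (\<Sum>e<2*n. Z a e * T e b c d) - (\<Sum>e<2*n. T a e c d * Z e b)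
                         + (\<Sum>e<2*n. Z c e * T a b e d) - (\<Sum>e<2*n. T a b c e * Z e d))"

definition evalw :: "nat \<Rightarrow> wt \<Rightarrow> cmat \<Rightarrow> complex" where
  "evalw n \<nu> H = (\<Sum>k\<in>{1..n}. of_int (\<nu> k) * H (k-1) (k-1))"

definition neg_l :: "nat \<Rightarrow> cmat set" where
  "neg_l n = {A \<in> lev n. (\<exists>i j. j < i \<and> i < n \<and> A = rv_minus n i j) \<or>
                         (\<exists>i j. i < j \<and> j < n \<and> A = rv_mm n i j)}"

definition lowest_vec :: "nat \<Rightarrow> wt \<Rightarrow> arr4 \<Rightarrow> bool" where
  "lowest_vec n \<nu> T \<longleftrightarrow> T \<in> LZbar n \<and>
     (\<forall>H\<in>cartan n. act4 n H T = (\<lambda>a b c d. - evalw n \<nu> H * T a b c d)) \<and>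
     (\<forall>E\<in>neg_l n. act4 n E T = (\<lambda>a b c d. 0))"

text \<open>W^* inside l (x) z(nbar) for W = V(nu): the l-submodule generated by the lowest
  weight vectors of weight -nu (the V(nu)^*-isotypic component).\<close>
inductive_set Wdual :: "nat \<Rightarrow> wt \<Rightarrow> arr4 set" for n :: nat and \<nu> :: wt where
  gen: "lowest_vec n \<nu> T \<Longrightarrow> T \<in> Wdual n \<nu>"
| zero: "(\<lambda>a b c d. 0) \<in> Wdual n \<nu>"
| add: "T \<in> Wdual n \<nu> \<Longrightarrow> T' \<in> Wdual n \<nu> \<Longrightarrow> (\<lambda>a b c d. T a b c d + T' a b c d) \<in> Wdual n \<nu>"
| scl: "T \<in> Wdual n \<nu> \<Longrightarrow> (\<lambda>a b c d. k * T a b c d) \<in> Wdual n \<nu>"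
| act: "Z \<in> lev n \<Longrightarrow> T \<in> Wdual n \<nu> \<Longrightarrow> act4 n Z T \<in> Wdual n \<nu>"

text \<open>Conformal invariance of the Omega_2|_{V(nu)^*} system on L_s (BKZ criterion).\<close>
definition conf_inv :: "nat \<Rightarrow> wt \<Rightarrow> complex \<Rightarrow> bool" where
  "conf_inv n \<nu> s \<longleftrightarrow> (\<forall>X\<in>nrad n. \<forall>Y\<in>Wdual n \<nu>. lmul X (omega2 n Y) \<in> Kid n s)"

text \<open>Weights and roots of D_n in eps-coordinates (1-based).\<close>
definition epsw :: "nat \<Rightarrow> wt" where
  "epsw k = (\<lambda>i. if i = k then 1 else 0)"

definition rootsD :: "nat \<Rightarrow> wt set" where
  "rootsD n = {(\<lambda>i. \<sigma> * epsw j i + \<tau> * epsw k i) | j k \<sigma> \<tau>.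
                 1 \<le> j \<and> j < k \<and> k \<le> n \<and> \<sigma> \<in> {1,-1} \<and> \<tau> \<in> {1,-1}}"

definition rootsg1 :: "nat \<Rightarrow> wt set" where
  "rootsg1 n = {(\<lambda>i. epsw j i + \<sigma> * epsw k i) | j k \<sigma>.
                 1 \<le> j \<and> j \<le> n-2 \<and> (k = n-1 \<or> k = n) \<and> \<sigma> \<in> {1,-1}}"

definition Delta_nu :: "nat \<Rightarrow> wt \<Rightarrow> wt set" where
  "Delta_nu n \<nu> = {\<alpha> \<in> rootsg1 n. (\<lambda>i. \<nu> i - \<alpha> i) \<in> rootsD n}"

definition mu :: "nat \<Rightarrow> wt" where
  "mu n = (\<lambda>i. epsw 1 i + epsw (n-1) i)"

end

theory Submission
  imports Defs "HOL-Analysis.Analysis"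
begin

text \<open>
  Put $m = n-2$. The defining space of $so(2n)$ splits as $U \oplus V \oplus U^*$ with $\dim U = m$ and
  $\dim V = 4$, so that $g(1) = U \otimes V$ and $g(-2) = \Lambda^2 U^*$. For $C \otimes D$ in
  $l \otimes z(\bar n)$ the quadratic form on $g(1)$ is
  $X \mapsto \frac12 \kappa(C, ad(X)^2 D)$, and its polarization $B$ is a symmetric form on $U$
  times the invariant form on $V$ plus a tensor that is antisymmetric in both factors. For every such $B$ and
  every $X$ in $g(1)$, the vector $X \cdot \omega_2$ of the generalized Verma module is $1-s$
  times a nonzero multiple of $B(X, \cdot) \in g(-1)$; the dimension 4 of $V$ is what makes
  the factor the same on the two kinds of forms. Hence $s = 1$ always works, and it is the only solution as soon as
  some $B$ is nonzero and $g(-1)$ injects into the generalized Verma module. An explicit lowest weight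
  vector settles the former. For the latter, $gl(2n)$ acts by twisted vector fields on the polynomials on
  an affine chart of the Grassmannian of $m$-planes; evaluating at the base point the result of applying a word
  to a coordinate function gives a functional that vanishes on the defining relations of the module.
  Finally $|\Delta_\nu(g(1))| = 4$ in all three cases.
\<close>

section \<open>A functional on the generalized Verma module\<close>

text \<open>Origin of the dimension 4: moving \<open>X\<close> from g(1) through two letters of
  g(-1) leaves two character terms and one double bracket. Let R be the contraction of B with
  \<open>X\<close>, T the same with the \<open>U\<close>-indices of B exchanged, and P the
  contribution of the symmetric part, so that R + T = 2P. With d = dim V the total is proportional
  to -2sR - 2T + dP = 2(1 - s)R + (d - 4)P. For d = 4 the defect disappears. So V(2 eps_1), which
  belongs to the symmetric part, shares its value of s with the other two constituents, which belong
  to the two halves of Lambda^2 V under so(4) = sl(2) + sl(2). The obstacle is to refute membership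
  in \<open>Kid\<close>, an inductively generated set of functions on words with arbitrary matrices
  as letters: this takes a linear functional that kills every generator. The functional is built for
  gl(2n), because the chart of the full Grassmannian is a space of free matrix entries, whereas
  isotropy would impose quadratic equations on the coordinates.\<close>

inductive_set polyfun :: "(cmat \<Rightarrow> complex) set" where
  const: "(\<lambda>Z. c) \<in> polyfun"
| coord: "(\<lambda>Z. Z a i) \<in> polyfun"
| add: "\<phi> \<in> polyfun \<Longrightarrow> \<psi> \<in> polyfun \<Longrightarrow> (\<lambda>Z. \<phi> Z + \<psi> Z) \<in> polyfun"
| mult: "\<phi> \<in> polyfun \<Longrightarrow> \<psi> \<in> polyfun \<Longrightarrow> (\<lambda>Z. \<phi> Z * \<psi> Z) \<in> polyfun"

lemma polyfun_cmult: "\<phi> \<in> polyfun \<Longrightarrow> (\<lambda>Z. c * \<phi> Z) \<in> polyfun"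
  by (intro polyfun.mult polyfun.const)

lemma polyfun_diff:
  assumes "\<phi> \<in> polyfun" "\<psi> \<in> polyfun"
  shows "(\<lambda>Z. \<phi> Z - \<psi> Z) \<in> polyfun"
  using polyfun.add[OF assms(1) polyfun_cmult[OF assms(2), of "-1"]]
  by (simp only: mult_minus_left mult_1 add_uminus_conv_diff)

lemma polyfun_sum: "(\<And>k. k \<in> S \<Longrightarrow> \<phi> k \<in> polyfun) \<Longrightarrow> (\<lambda>Z. \<Sum>k\<in>S. \<phi> k Z) \<in> polyfun"
  by (induction S rule: infinite_finite_induct) (auto intro: polyfun.intros)

text \<open>\<open>deriv\<close> is total, so the operators make sense on all functions.
  Differentiability comes from \<open>polyfun\<close>, which is closed under all the operators built
  below, so that they can be iterated.\<close>

definition along :: "(cmat \<Rightarrow> complex) \<Rightarrow> cmat \<Rightarrow> cmat \<Rightarrow> complex" where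
  "along \<phi> Z v = deriv (\<lambda>t. \<phi> (\<lambda>a i. Z a i + t * v a i)) 0"

lemma polyfun_has_derivative:
  assumes "\<phi> \<in> polyfun"
  shows "((\<lambda>t. \<phi> (\<lambda>a i. Z a i + t * v a i)) has_field_derivative along \<phi> Z v) (at 0)"
proof -
  have "\<exists>D. ((\<lambda>t. \<phi> (\<lambda>a i. Z a i + t * v a i)) has_field_derivative D) (at 0)"
    using assms
  proof induction
    case (const c) show ?case by (auto intro!: exI derivative_eq_intros)
  next
    case (coord a i) show ?case by (auto intro!: exI derivative_eq_intros)
  next
    case (add \<phi> \<psi>)
    then obtain D E where "((\<lambda>t. \<phi> (\<lambda>a i. Z a i + t * v a i)) has_field_derivative D) (at 0)"
      "((\<lambda>t. \<psi> (\<lambda>a i. Z a i + t * v a i)) has_field_derivative E) (at 0)" by blast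
    from DERIV_add[OF this] show ?case by (rule exI)
  next
    case (mult \<phi> \<psi>)
    then obtain D E where "((\<lambda>t. \<phi> (\<lambda>a i. Z a i + t * v a i)) has_field_derivative D) (at 0)"
      "((\<lambda>t. \<psi> (\<lambda>a i. Z a i + t * v a i)) has_field_derivative E) (at 0)" by blast
    from DERIV_mult[OF this] show ?case by (rule exI)
  qed
  then obtain D where D: "((\<lambda>t. \<phi> (\<lambda>a i. Z a i + t * v a i)) has_field_derivative D) (at 0)" by blast
  then show ?thesis unfolding along_def DERIV_imp_deriv[OF D] .
qed

lemma along_eqI:
  "((\<lambda>t. \<phi> (\<lambda>a i. Z a i + t * v a i)) has_field_derivative D) (at 0) \<Longrightarrow> along \<phi> Z v = D"
  unfolding along_def by (rule DERIV_imp_deriv)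

lemma along_const: "along (\<lambda>Z. c) Z v = 0"
  by (intro along_eqI) auto

lemma along_coord: "along (\<lambda>Z. Z a i) Z v = v a i"
  by (intro along_eqI) (auto intro!: derivative_eq_intros)

lemma along_add:
  assumes "\<phi> \<in> polyfun" "\<psi> \<in> polyfun"
  shows "along (\<lambda>Z. \<phi> Z + \<psi> Z) Z v = along \<phi> Z v + along \<psi> Z v"
  by (intro along_eqI DERIV_add polyfun_has_derivative assms)

lemma along_mult:
  assumes "\<phi> \<in> polyfun" "\<psi> \<in> polyfun"
  shows "along (\<lambda>Z. \<phi> Z * \<psi> Z) Z v = along \<phi> Z v * \<psi> Z + \<phi> Z * along \<psi> Z v"
proof (rule along_eqI)
  show "((\<lambda>t. \<phi> (\<lambda>a i. Z a i + t * v a i) * \<psi> (\<lambda>a i. Z a i + t * v a i)) has_field_derivative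
      along \<phi> Z v * \<psi> Z + \<phi> Z * along \<psi> Z v) (at 0)"
    using DERIV_mult[OF polyfun_has_derivative[OF assms(1), of Z v]
        polyfun_has_derivative[OF assms(2), of Z v]]
    by (simp add: algebra_simps)
qed

lemma along_cmult:
  assumes "\<phi> \<in> polyfun"
  shows "along (\<lambda>Z. c * \<phi> Z) Z v = c * along \<phi> Z v"
  by (simp add: along_mult[OF polyfun.const assms] along_const)

lemma along_diff:
  assumes "\<phi> \<in> polyfun" "\<psi> \<in> polyfun"
  shows "along (\<lambda>Z. \<phi> Z - \<psi> Z) Z v = along \<phi> Z v - along \<psi> Z v"
  by (intro along_eqI DERIV_diff polyfun_has_derivative assms)

lemma along_sum:
  assumes "\<And>k. k \<in> S \<Longrightarrow> \<phi> k \<in> polyfun"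
  shows "along (\<lambda>Z. \<Sum>k\<in>S. \<phi> k Z) Z v = (\<Sum>k\<in>S. along (\<phi> k) Z v)"
  by (intro along_eqI DERIV_sum polyfun_has_derivative assms)

text \<open>Induction on the polynomial: for a general function the derivative along a line need not
  be additive in the direction.\<close>

lemma along_dir_linear:
  assumes "\<phi> \<in> polyfun"
  shows "along \<phi> Z (\<lambda>a i. c * v a i + d * w a i) = c * along \<phi> Z v + d * along \<phi> Z w"
  using assms
  by induction (simp_all add: along_const along_coord along_add along_mult algebra_simps)

lemma along_dir_zero: "along \<phi> Z (\<lambda>a i. 0) = 0"
  by (intro along_eqI) auto

section \<open>Vector fields and cocycle on the Grassmannian chart\<close>

lemma mmul_assoc: "mmul n (mmul n A B) C = mmul n A (mmul n B C)"
proof (intro ext)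
  fix i j
  have "mmul n (mmul n A B) C i j = (\<Sum>l<2*n. \<Sum>k<2*n. A i k * (B k l * C l j))"
    unfolding mmul_def by (simp add: sum_distrib_right mult.assoc)
  also have "\<dots> = (\<Sum>k<2*n. \<Sum>l<2*n. A i k * (B k l * C l j))" by (rule sum.swap)
  also have "\<dots> = mmul n A (mmul n B C) i j"
    unfolding mmul_def by (simp add: sum_distrib_left)
  finally show "mmul n (mmul n A B) C i j = mmul n A (mmul n B C) i j" .
qed

lemma mmul_lin_left: "mmul n (\<lambda>a b. c * A a b + d * B a b) C a b = c * mmul n A C a b + d * mmul n B C a b"
  by (simp add: mmul_def sum.distrib sum_distrib_left algebra_simps)

lemma mmul_lin_right: "mmul n C (\<lambda>a b. c * A a b + d * B a b) a b = c * mmul n C A a b + d * mmul n C B a b"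
  by (simp add: mmul_def sum.distrib sum_distrib_left algebra_simps)

lemma mmul_diff_left: "mmul n (\<lambda>a b. A a b - B a b) C a b = mmul n A C a b - mmul n B C a b"
  by (simp add: mmul_def sum_subtractf algebra_simps)

lemma mmul_diff_right: "mmul n C (\<lambda>a b. A a b - B a b) a b = mmul n C A a b - mmul n C B a b"
  by (simp add: mmul_def sum_subtractf algebra_simps)

text \<open>
  The point \<open>Z\<close> of the chart is the span of the first \<open>m\<close> columns of \<open>frame m Z\<close>. Padding the frame with
  zero columns to a square matrix \<open>x\<close> lets the action of \<open>X\<close> on the chart be written as
  \<open>X x - x X x\<close> with ordinary matrix products.
\<close>

definition frame :: "nat \<Rightarrow> cmat \<Rightarrow> cmat" where
  "frame m Z = (\<lambda>a i. if i < m then if a < m then of_bool (a = i) else Z a i else 0)"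

definition vfield :: "nat \<Rightarrow> nat \<Rightarrow> cmat \<Rightarrow> cmat \<Rightarrow> cmat" where
  "vfield n m X Z = (\<lambda>a i. mmul n X (frame m Z) a i
     - mmul n (frame m Z) (mmul n X (frame m Z)) a i)"

text \<open>To first order in t the flow turns the identity block of the frame into 1 + t A, where A
  is the top block of \<open>X\<close> times the frame. The trace of A is the logarithmic derivative
  of its determinant, so \<open>twisted\<close> acts on sections of a power of the determinant line
  bundle.\<close>

definition cocycle :: "nat \<Rightarrow> nat \<Rightarrow> cmat \<Rightarrow> cmat \<Rightarrow> complex" where
  "cocycle n m X Z = (\<Sum>i<m. mmul n X (frame m Z) i i)"

definition twisted :: "nat \<Rightarrow> nat \<Rightarrow> complex \<Rightarrow> cmat \<Rightarrow> (cmat \<Rightarrow> complex) \<Rightarrow> cmat \<Rightarrow> complex" where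
  "twisted n m s X \<phi> = (\<lambda>Z. along \<phi> Z (vfield n m X Z) - s * cocycle n m X Z * \<phi> Z)"

lemma polyfun_frame: "(\<lambda>Z. frame m Z a i) \<in> polyfun"
  unfolding frame_def by (cases "i < m"; cases "a < m") (auto intro: polyfun.intros)

lemma polyfun_mmul_frame: "(\<lambda>Z. mmul n X (frame m Z) a i) \<in> polyfun"
  unfolding mmul_def by (intro polyfun_sum polyfun.mult polyfun.const polyfun_frame)

lemma polyfun_vfield: "(\<lambda>Z. vfield n m X Z a i) \<in> polyfun"
  unfolding vfield_def mmul_def[of n "frame m _"]
  by (intro polyfun_diff polyfun_sum polyfun.mult polyfun_frame polyfun_mmul_frame)

lemma polyfun_cocycle: "cocycle n m X \<in> polyfun"
proof -
  have "(\<lambda>Z. cocycle n m X Z) \<in> polyfun"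
    unfolding cocycle_def by (intro polyfun_sum polyfun_mmul_frame)
  then show ?thesis by simp
qed

lemma polyfun_along:
  assumes "\<phi> \<in> polyfun" "\<And>a i. (\<lambda>Z. v Z a i) \<in> polyfun"
  shows "(\<lambda>Z. along \<phi> Z (v Z)) \<in> polyfun"
  using assms(1)
  by induction (auto simp: along_const along_coord along_add along_mult intro: polyfun.intros assms(2))

lemma polyfun_twisted: "\<phi> \<in> polyfun \<Longrightarrow> twisted n m s X \<phi> \<in> polyfun"
  unfolding twisted_def
  by (intro polyfun_diff polyfun_along polyfun.mult polyfun.const polyfun_vfield polyfun_cocycle)

text \<open>The quadratic correction restores the identity block of the frame, so the field is
  tangent to the chart. Hence the constant entries of \<open>frame\<close> obey the same
  differentiation rule as the coordinates.\<close>

lemma vfield_zero: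
  assumes "m \<le> 2 * n" "a < m \<or> m \<le> i"
  shows "vfield n m X Z a i = 0"
proof (cases "i < m")
  case True
  then have "a < m" using assms by auto
  have "mmul n (frame m Z) (mmul n X (frame m Z)) a i
      = (\<Sum>k<2*n. if k = a then mmul n X (frame m Z) k i else 0)"
    unfolding mmul_def[of n "frame m Z"] using \<open>a < m\<close>
    by (intro sum.cong) (auto simp: frame_def)
  then show ?thesis using \<open>a < m\<close> assms by (simp add: vfield_def)
next
  case False
  then have "frame m Z k i = 0" for k by (simp add: frame_def)
  then show ?thesis by (simp add: vfield_def mmul_def)
qed

lemma along_frame:
  assumes "m \<le> 2 * n"
  shows "along (\<lambda>Z. frame m Z a i) Z (vfield n m Y Z) = vfield n m Y Z a i"
proof (cases "i < m \<and> m \<le> a")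
  case True
  then have "(\<lambda>Z. frame m Z a i) = (\<lambda>Z. Z a i)" by (auto simp: frame_def)
  then show ?thesis by (simp add: along_coord)
next
  case False
  then have "(\<lambda>Z. frame m Z a i) = (\<lambda>Z. if i < m then of_bool (a = i) else 0)"
    by (auto simp: frame_def)
  then show ?thesis using vfield_zero[OF assms, of a i] False by (auto simp: along_const not_less not_le)
qed

lemma along_mmul_frame:
  assumes "m \<le> 2 * n"
  shows "along (\<lambda>Z. mmul n X (frame m Z) a i) Z (vfield n m Y Z) = mmul n X (vfield n m Y Z) a i"
  unfolding mmul_def
  by (simp add: along_sum along_cmult polyfun_cmult polyfun_frame along_frame[OF assms])

lemma along_vfield:
  assumes "m \<le> 2 * n"
  shows "along (\<lambda>Z. vfield n m X Z a i) Z (vfield n m Y Z) =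
    mmul n X (vfield n m Y Z) a i - mmul n (vfield n m Y Z) (mmul n X (frame m Z)) a i
    - mmul n (frame m Z) (mmul n X (vfield n m Y Z)) a i"
proof -
  have p: "(\<lambda>Z. mmul n (frame m Z) (mmul n X (frame m Z)) a i) \<in> polyfun"
    unfolding mmul_def[of n "frame m _"]
    by (intro polyfun_sum polyfun.mult polyfun_frame polyfun_mmul_frame)
  have "along (\<lambda>Z. mmul n (frame m Z) (mmul n X (frame m Z)) a i) Z (vfield n m Y Z)
     = mmul n (vfield n m Y Z) (mmul n X (frame m Z)) a i
     + mmul n (frame m Z) (mmul n X (vfield n m Y Z)) a i"
    unfolding mmul_def[of n "frame m _"] mmul_def[of n "vfield n m Y Z"]
    by (simp add: along_sum along_mult polyfun.mult polyfun_frame polyfun_mmul_frame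
        along_frame[OF assms] along_mmul_frame[OF assms] sum.distrib)
  then show ?thesis
    unfolding vfield_def[of n m X]
    by (simp add: along_diff[OF polyfun_mmul_frame p] along_mmul_frame[OF assms])
qed

lemma mmul_vfield:
  "mmul n X (vfield n m Y Z) a i = mmul n X (mmul n Y (frame m Z)) a i
     - mmul n X (mmul n (frame m Z) (mmul n Y (frame m Z))) a i"
  unfolding vfield_def by (simp add: mmul_diff_right)

text \<open>With x the frame and w = Y x - x Y x, the derivative of X x - x X x along w is X w - w X
  x - x X w. In the expansion only X Y x - x X Y x fails to be symmetric in \<open>X\<close> and
  \<open>Y\<close>.\<close>

lemma vfield_brk:
  assumes "m \<le> 2 * n"
  shows "along (\<lambda>Z. vfield n m X Z a i) Z (vfield n m Y Z) - along (\<lambda>Z. vfield n m Y Z a i) Z (vfield n m X Z)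
    = vfield n m (brk n X Y) Z a i"
proof -
  have *: "mmul n (\<lambda>i j. A i j - B i j) C = (\<lambda>a b. mmul n A C a b - mmul n B C a b)"
       "mmul n C (\<lambda>i j. A i j - B i j) = (\<lambda>a b. mmul n C A a b - mmul n C B a b)" for A B C
    by (intro ext mmul_diff_left mmul_diff_right)+
  show ?thesis
    unfolding along_vfield[OF assms] by (simp add: vfield_def brk_def * mmul_assoc)
qed

text \<open>Besides the trace of X Y x, the derivative contains the trace of the product of the top
  blocks of X x and Y x. That trace is symmetric in \<open>X\<close> and \<open>Y\<close> and
  cancels.\<close>

lemma cocycle_brk:
  assumes "m \<le> 2 * n"
  shows "along (cocycle n m X) Z (vfield n m Y Z) - along (cocycle n m Y) Z (vfield n m X Z)
    = cocycle n m (brk n X Y) Z"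
proof -
  have *: "along (cocycle n m X) Z (vfield n m Y Z) = (\<Sum>i<m. mmul n X (vfield n m Y Z) i i)" for X Y
    unfolding cocycle_def[abs_def]
    by (simp add: along_sum polyfun_mmul_frame along_mmul_frame[OF assms])
  have tr: "(\<Sum>i<m. mmul n X (mmul n (frame m Z) (mmul n Y (frame m Z))) i i)
     = (\<Sum>i<m. \<Sum>j<m. mmul n X (frame m Z) i j * mmul n Y (frame m Z) j i)" for X Y
  proof (rule sum.cong)
    fix i
    have "mmul n X (mmul n (frame m Z) (mmul n Y (frame m Z))) i i
        = mmul n (mmul n X (frame m Z)) (mmul n Y (frame m Z)) i i" by (simp add: mmul_assoc)
    also have "\<dots> = (\<Sum>j<m. mmul n X (frame m Z) i j * mmul n Y (frame m Z) j i)"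
      unfolding mmul_def[of n "mmul n X (frame m Z)"] using assms
      by (intro sum.mono_neutral_right) (auto simp: mmul_def frame_def)
    finally show "mmul n X (mmul n (frame m Z) (mmul n Y (frame m Z))) i i =
      (\<Sum>j<m. mmul n X (frame m Z) i j * mmul n Y (frame m Z) j i)" .
  qed simp
  have sym: "(\<Sum>i<m. mmul n X (mmul n (frame m Z) (mmul n Y (frame m Z))) i i)
      = (\<Sum>i<m. mmul n Y (mmul n (frame m Z) (mmul n X (frame m Z))) i i)"
    unfolding tr by (subst sum.swap) (simp add: mult.commute)
  show ?thesis
    unfolding * mmul_vfield
    using sym by (simp add: sum_subtractf cocycle_def brk_def mmul_diff_left mmul_assoc)
qed

text \<open>Both sides are derivations in \<open>\<phi>\<close>, so it suffices to compare them on
  coordinates, where the claim is \<open>vfield_brk\<close>.\<close>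

lemma along_brk:
  assumes m: "m \<le> 2 * n" and "\<phi> \<in> polyfun"
  shows "along (\<lambda>Z. along \<phi> Z (vfield n m X Z)) Z (vfield n m Y Z)
     - along (\<lambda>Z. along \<phi> Z (vfield n m Y Z)) Z (vfield n m X Z)
     = along \<phi> Z (vfield n m (brk n X Y) Z)"
  using assms(2)
proof induction
  case (const c)
  then show ?case by (simp add: along_const)
next
  case (coord a i)
  then show ?case by (simp add: along_coord vfield_brk[OF m])
next
  case (add \<phi> \<psi>)
  then show ?case
    by (simp add: along_add polyfun_along polyfun_vfield algebra_simps)
next
  case (mult \<phi> \<psi>)
  have pv: "(\<lambda>Z. along \<phi> Z (vfield n m X Z)) \<in> polyfun" "(\<lambda>Z. along \<psi> Z (vfield n m X Z)) \<in> polyfun" for X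
    using mult.hyps by (auto intro: polyfun_along polyfun_vfield)
  show ?case
    unfolding mult.IH[symmetric] along_mult[OF mult.hyps]
    by (simp add: along_add along_mult polyfun.mult mult.hyps pv mult.IH[symmetric] algebra_simps)
qed

text \<open>Note the reversed order on the left: as always for the vector fields of a left action,
  \<open>X\<close> is sent to its operator by an antihomomorphism.\<close>

lemma twisted_brk:
  assumes m: "m \<le> 2 * n" and "\<phi> \<in> polyfun"
  shows "twisted n m s Y (twisted n m s X \<phi>) Z - twisted n m s X (twisted n m s Y \<phi>) Z
     = twisted n m s (brk n X Y) \<phi> Z"
proof -
  have pv: "(\<lambda>Z. along \<phi> Z (vfield n m X Z)) \<in> polyfun" for X
    using assms by (auto intro: polyfun_along polyfun_vfield)
  have pc: "(\<lambda>Z. s * cocycle n m X Z) \<in> polyfun" for X by (intro polyfun_cmult polyfun_cocycle)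
  have al: "along (twisted n m s X \<phi>) Z v = along (\<lambda>Z. along \<phi> Z (vfield n m X Z)) Z v
     - s * (along (cocycle n m X) Z v * \<phi> Z + cocycle n m X Z * along \<phi> Z v)" for X v
    unfolding twisted_def
    by (subst along_diff[OF pv polyfun.mult[OF pc assms(2)]], subst along_mult[OF pc assms(2)])
       (simp add: along_cmult polyfun_cocycle algebra_simps)
  show ?thesis
    unfolding twisted_def[of n m s _ "twisted _ _ _ _ _"] twisted_def[of n m s "brk n X Y"]
      along_brk[OF assms, symmetric] cocycle_brk[OF m, symmetric] al
    unfolding twisted_def by (simp add: algebra_simps)
qed

lemma twisted_linear:
  assumes "\<phi> \<in> polyfun" "\<psi> \<in> polyfun"
  shows "twisted n m s X (\<lambda>Z. c * \<phi> Z + d * \<psi> Z) = (\<lambda>Z. c * twisted n m s X \<phi> Z + d * twisted n m s X \<psi> Z)"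
  unfolding twisted_def
  by (simp add: along_add along_cmult polyfun_cmult assms algebra_simps)

lemma twisted_linear_field:
  assumes "\<phi> \<in> polyfun"
  shows "twisted n m s (\<lambda>a b. c * X a b + d * Y a b) \<phi> = (\<lambda>Z. c * twisted n m s X \<phi> Z + d * twisted n m s Y \<phi> Z)"
proof -
  have 1: "mmul n (\<lambda>a b. c * X a b + d * Y a b) C = (\<lambda>a b. c * mmul n X C a b + d * mmul n Y C a b)" for C
    by (intro ext) (rule mmul_lin_left)
  have "vfield n m (\<lambda>a b. c * X a b + d * Y a b) Z = (\<lambda>a i. c * vfield n m X Z a i + d * vfield n m Y Z a i)" for Z
    unfolding vfield_def 1 mmul_lin_right by (simp add: algebra_simps)
  moreover have "cocycle n m (\<lambda>a b. c * X a b + d * Y a b) Z = c * cocycle n m X Z + d * cocycle n m Y Z" for Z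
    unfolding cocycle_def 1 by (simp add: sum.distrib sum_distrib_left)
  ultimately show ?thesis
    unfolding twisted_def by (simp add: along_dir_linear[OF assms] algebra_simps)
qed

text \<open>\<open>foldl\<close> applies the first letter first and the last letter last. This order
  absorbs the reversal in \<open>twisted_brk\<close>, and it makes a final letter from q act right
  before the evaluation at the base point, where it becomes a scalar.\<close>

definition words :: "nat \<Rightarrow> nat \<Rightarrow> complex \<Rightarrow> (cmat \<Rightarrow> complex) \<Rightarrow> cmat list \<Rightarrow> cmat \<Rightarrow> complex" where
  "words n m s \<phi> w = foldl (\<lambda>\<psi> X. twisted n m s X \<psi>) \<phi> w"

lemma words_append: "words n m s \<phi> (u @ w) = words n m s (words n m s \<phi> u) w"
  by (simp add: words_def)

lemma words_Nil: "words n m s \<phi> [] = \<phi>" by (simp add: words_def)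

lemma words_Cons: "words n m s \<phi> (X # w) = words n m s (twisted n m s X \<phi>) w"
  by (simp add: words_def)

lemma polyfun_words: "\<phi> \<in> polyfun \<Longrightarrow> words n m s \<phi> w \<in> polyfun"
  by (induction w arbitrary: \<phi>) (auto simp: words_Nil words_Cons polyfun_twisted)

lemma words_linear:
  assumes "\<phi> \<in> polyfun" "\<psi> \<in> polyfun"
  shows "words n m s (\<lambda>Z. c * \<phi> Z + d * \<psi> Z) w = (\<lambda>Z. c * words n m s \<phi> w Z + d * words n m s \<psi> w Z)"
  using assms
  by (induction w arbitrary: \<phi> \<psi>) (auto simp: words_Nil words_Cons twisted_linear polyfun_twisted)

text \<open>The base point of the chart is the subspace \<open>U\<close> itself, which q stabilizes.
  So the vector field vanishes there, and the cocycle is the trace of the block on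
  \<open>U\<close>.\<close>

lemma twisted_qpar:
  assumes "z \<in> qpar n"
  shows "twisted n (n-2) s z \<phi> (\<lambda>a i. 0) = chi n s z * \<phi> (\<lambda>a i. 0)"
proof -
  have z0: "z a i = 0" if "n - 2 \<le> a" "i < n - 2" for a i
  proof (rule ccontr)
    assume "z a i \<noteq> 0"
    then have "hq n a - hq n i \<ge> 0" using assms unfolding qpar_def gpart_def by blast
    then show False using that by (auto simp: hq_def split: if_splits)
  qed
  let ?x = "frame (n-2) (\<lambda>a i. 0)"
  have zx: "mmul n z ?x a i = (if i < n-2 then z a i else 0)" for a i
  proof -
    have "mmul n z ?x a i = (\<Sum>k<2*n. if k = i then (if i < n - 2 then z a k else 0) else 0)"
      unfolding mmul_def by (intro sum.cong) (auto simp: frame_def)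
    then show ?thesis by (auto simp: sum.delta)
  qed
  have "vfield n (n-2) z (\<lambda>a i. 0) a i = 0" for a i
  proof (cases "a < n - 2 \<or> n - 2 \<le> i")
    case True then show ?thesis by (intro vfield_zero) auto
  next
    case False
    have "mmul n ?x C a i = 0" for C
      unfolding mmul_def using False by (intro sum.neutral) (auto simp: frame_def)
    then show ?thesis using False by (simp add: vfield_def zx z0)
  qed
  then have "vfield n (n-2) z (\<lambda>a i. 0) = (\<lambda>a i. 0)" by blast
  then show ?thesis
    unfolding twisted_def by (simp add: along_dir_zero cocycle_def zx chi_def)
qed

text \<open>The functional is a sum over the support of \<open>f\<close>. Asking for the value 0 on
  all sufficiently large finite sets of words avoids carrying finiteness of the support through the
  induction.\<close>

lemma Kid_functional:
  assumes "f \<in> Kid n s" and "\<phi> \<in> polyfun"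
  shows "\<exists>S. finite S \<and> (\<forall>S'. finite S' \<longrightarrow> S \<subseteq> S' \<longrightarrow>
     (\<Sum>v\<in>S'. f v * words n (n-2) s \<phi> v (\<lambda>a i. 0)) = 0)"
proof -
  define F where "F v = words n (n-2) s \<phi> v (\<lambda>a i. 0)" for v
  have wd: "(\<Sum>v\<in>S'. wd w v * F v) = F w" if "finite S'" "w \<in> S'" for w S'
    using that by (simp add: wd_def sum.delta if_distrib[of "\<lambda>x. x * _"] cong: if_cong)
  have m: "n - 2 \<le> 2 * n" by simp
  have "\<exists>S. finite S \<and> (\<forall>S'. finite S' \<longrightarrow> S \<subseteq> S' \<longrightarrow> (\<Sum>v\<in>S'. f v * F v) = 0)"
    using assms(1)
  proof induction
    case zero
    show ?case by (intro exI[of _ "{}"]) simp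
  next
    case (add f h)
    then obtain S T where "finite S" "\<forall>S'. finite S' \<longrightarrow> S \<subseteq> S' \<longrightarrow> (\<Sum>v\<in>S'. f v * F v) = 0"
      "finite T" "\<forall>S'. finite S' \<longrightarrow> T \<subseteq> S' \<longrightarrow> (\<Sum>v\<in>S'. h v * F v) = 0" by auto
    then show ?case by (intro exI[of _ "S \<union> T"]) (simp add: distrib_right sum.distrib)
  next
    case (scl f c)
    then obtain S where "finite S" "\<forall>S'. finite S' \<longrightarrow> S \<subseteq> S' \<longrightarrow> (\<Sum>v\<in>S'. f v * F v) = 0" by auto
    then show ?case by (intro exI[of _ S]) (simp add: mult.assoc sum_distrib_left[symmetric])
  next
    case (lin_add u w x y)
    let ?p = "words n (n-2) s \<phi> u"
    have p: "?p \<in> polyfun" by (rule polyfun_words[OF assms(2)])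
    have "F (u @ [\<lambda>a b. x a b + y a b] @ w) = F (u @ [x] @ w) + F (u @ [y] @ w)"
      unfolding F_def words_append words_Cons words_Nil
      using twisted_linear_field[OF p, of n "n-2" s 1 x 1 y]
        words_linear[OF polyfun_twisted[OF p] polyfun_twisted[OF p], of n "n-2" s 1 _ _ _ x 1 _ _ _ y w]
      by simp
    then show ?case
      by (intro exI[of _ "{u @ [\<lambda>a b. x a b + y a b] @ w, u @ [x] @ w, u @ [y] @ w}"])
         (simp add: left_diff_distrib sum_subtractf wd)
  next
    case (lin_scl u w x c)
    let ?p = "words n (n-2) s \<phi> u"
    have p: "?p \<in> polyfun" by (rule polyfun_words[OF assms(2)])
    have "F (u @ [msc c x] @ w) = c * F (u @ [x] @ w)"
      unfolding F_def words_append words_Cons words_Nil msc_def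
      using twisted_linear_field[OF p, of n "n-2" s c x 0 x]
        words_linear[OF polyfun_twisted[OF p] polyfun_twisted[OF p], of n "n-2" s c _ _ _ x 0 _ _ _ x w]
      by simp
    then show ?case
      by (intro exI[of _ "{u @ [msc c x] @ w, u @ [x] @ w}"])
         (simp add: left_diff_distrib sum_subtractf wd mult.assoc sum_distrib_left[symmetric])
  next
    case (comm u w x y)
    let ?p = "words n (n-2) s \<phi> u"
    have p: "?p \<in> polyfun" by (rule polyfun_words[OF assms(2)])
    have "twisted n (n-2) s (brk n x y) ?p = (\<lambda>Z. 1 * twisted n (n-2) s y (twisted n (n-2) s x ?p) Z
         + (-1) * twisted n (n-2) s x (twisted n (n-2) s y ?p) Z)"
      using twisted_brk[OF m p, of s y x] by (intro ext) simp
    then have "F (u @ [brk n x y] @ w) = F (u @ [x, y] @ w) - F (u @ [y, x] @ w)"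
      unfolding F_def words_append words_Cons words_Nil
      using words_linear[OF polyfun_twisted[OF polyfun_twisted[OF p]] polyfun_twisted[OF polyfun_twisted[OF p]],
           of n "n-2" s 1 _ _ _ y _ _ _ x "-1" _ _ _ x _ _ _ y w]
      by simp
    then show ?case
      by (intro exI[of _ "{u @ [x, y] @ w, u @ [y, x] @ w, u @ [brk n x y] @ w}"])
         (simp add: left_diff_distrib sum_subtractf wd)
  next
    case (par u z)
    have "F (u @ [z]) = chi n s z * F u"
      unfolding F_def words_append words_Cons words_Nil using par twisted_qpar by blast
    then show ?case
      by (intro exI[of _ "{u @ [z], u}"])
         (simp add: left_diff_distrib sum_subtractf wd mult.assoc sum_distrib_left[symmetric])
  qed
  then show ?thesis unfolding F_def .
qed

text \<open>The test function is the coordinate \<open>Z q j\<close>. It vanishes at the base point,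
  which removes the cocycle term, and its derivative there along the field of \<open>F\<close> is
  the entry \<open>F q j\<close>.\<close>

lemma letter_notin_Kid:
  assumes "n - 2 \<le> q" "j < n - 2" "F q j \<noteq> 0"
  shows "wd [F] \<notin> Kid n s"
proof
  assume "wd [F] \<in> Kid n s"
  from Kid_functional[OF this polyfun.coord[of q j]] obtain S where
    "finite S" "\<forall>S'. finite S' \<longrightarrow> S \<subseteq> S' \<longrightarrow>
     (\<Sum>v\<in>S'. wd [F] v * words n (n-2) s (\<lambda>Z. Z q j) v (\<lambda>a i. 0)) = 0" by blast
  then have "(\<Sum>v\<in>insert [F] S. wd [F] v * words n (n-2) s (\<lambda>Z. Z q j) v (\<lambda>a i. 0)) = 0" by blast
  then have "words n (n-2) s (\<lambda>Z. Z q j) [F] (\<lambda>a i. 0) = 0"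
    using \<open>finite S\<close> by (simp add: wd_def sum.delta if_distrib[of "\<lambda>x. x * _"] cong: if_cong)
  then have *: "vfield n (n-2) F (\<lambda>a i. 0) q j = 0"
    by (simp add: words_def twisted_def along_coord)
  have "mmul n F (frame (n-2) (\<lambda>a i. 0)) q j = (\<Sum>k<2*n. if k = j then F q k else 0)"
    unfolding mmul_def using assms by (intro sum.cong) (auto simp: frame_def)
  then have "mmul n F (frame (n-2) (\<lambda>a i. 0)) q j = F q j" using assms by simp
  moreover have "mmul n (frame (n-2) (\<lambda>a i. 0)) C q j = 0" for C
    unfolding mmul_def using assms by (intro sum.neutral) (auto simp: frame_def)
  ultimately show False using * assms by (simp add: vfield_def)
qed

section \<open>Root vectors of the orthogonal Lie algebra\<close>

text \<open>Index \<open>cj n a\<close> carries the weight opposite to that of \<open>a\<close>; \<open>cj\<close> is an involution on indices below \<open>2*n\<close> only.\<close>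

definition cj :: "nat \<Rightarrow> nat \<Rightarrow> nat" where
  "cj n a = (if a < n then a + n else a - n)"

text \<open>One family for all root vectors and for the diagonal elements. It is redundant, as
  conjugating and exchanging the indices changes the sign, but in return all brackets are instances
  of the single four-term formula \<open>brk_Mb\<close>.\<close>

definition Mb :: "nat \<Rightarrow> nat \<Rightarrow> nat \<Rightarrow> cmat" where
  "Mb n a b = (\<lambda>x y. Emat a b x y - Emat (cj n b) (cj n a) x y)"

lemma cj_less: "a < 2 * n \<Longrightarrow> cj n a < 2 * n"
  by (auto simp: cj_def)

lemma cj_cj: "a < 2 * n \<Longrightarrow> cj n (cj n a) = a"
  by (auto simp: cj_def)

lemma cj_eq_iff: "a < 2 * n \<Longrightarrow> b < 2 * n \<Longrightarrow> cj n a = cj n b \<longleftrightarrow> a = b"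
  by (auto simp: cj_def split: if_splits)

lemma bij_betw_cj: "bij_betw (cj n) {..<2*n} {..<2*n}"
  by (rule bij_betwI[of _ _ _ "cj n"]) (auto simp: cj_less cj_cj)

lemma Mb_cj: "a < 2 * n \<Longrightarrow> b < 2 * n \<Longrightarrow> Mb n (cj n b) (cj n a) x y = - Mb n a b x y"
  by (simp add: Mb_def cj_cj)

lemma rv_Mb:
  assumes "i < n" "j < n"
  shows "rv_minus n i j = Mb n i j" "rv_pp n i j = Mb n i (n + j)" "rv_mm n i j = Mb n (n + j) i"
  using assms by (auto simp: rv_minus_def rv_pp_def rv_mm_def Mb_def cj_def add.commute)

lemma Emat_of_bool: "Emat a b x y = of_bool (x = a) * of_bool (y = b)"
  by (simp add: Emat_def)

lemma mmul_Emat_left: "b < 2 * n \<Longrightarrow> mmul n (Emat a b) A x y = of_bool (x = a) * A b y"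
  unfolding mmul_def Emat_def
  by (simp add: if_distrib[of "\<lambda>t. t * _"] sum.delta cong: if_cong)

lemma mmul_Emat_right: "a < 2 * n \<Longrightarrow> mmul n A (Emat a b) x y = A x a * of_bool (y = b)"
  unfolding mmul_def Emat_def
  by (auto simp: if_distrib[of "\<lambda>t. _ * t"] sum.delta cong: if_cong)

lemma mmul_Mb_left:
  "a < 2 * n \<Longrightarrow> b < 2 * n \<Longrightarrow>
    mmul n (Mb n a b) A x y = of_bool (x = a) * A b y - of_bool (x = cj n b) * A (cj n a) y"
  by (simp add: Mb_def mmul_diff_left mmul_Emat_left cj_less)

lemma mmul_Mb_right:
  "a < 2 * n \<Longrightarrow> b < 2 * n \<Longrightarrow>
    mmul n A (Mb n a b) x y = A x a * of_bool (y = b) - A x (cj n b) * of_bool (y = cj n a)"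
  by (simp add: Mb_def mmul_diff_right mmul_Emat_right cj_less)

lemma brk_Mb:
  assumes "a < 2 * n" "b < 2 * n" "c < 2 * n" "d < 2 * n"
  shows "brk n (Mb n a b) (Mb n c d) = (\<lambda>x y. of_bool (b = c) * Mb n a d x y - of_bool (d = a) * Mb n c b x y
     - of_bool (b = cj n d) * Mb n a (cj n c) x y + of_bool (cj n c = a) * Mb n (cj n d) b x y)"
proof (intro ext)
  fix x y
  have e: "(cj n a = c) = (cj n c = a)" "(cj n a = cj n d) = (d = a)" "(a = d) = (d = a)"
      "(a = cj n c) = (cj n c = a)" "(cj n b = d) = (b = cj n d)" "(cj n b = cj n c) = (b = c)"
    using assms by (auto simp: cj_cj cj_eq_iff)
  show "brk n (Mb n a b) (Mb n c d) x y = of_bool (b = c) * Mb n a d x y - of_bool (d = a) * Mb n c b x y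
     - of_bool (b = cj n d) * Mb n a (cj n c) x y + of_bool (cj n c = a) * Mb n (cj n d) b x y"
    unfolding brk_def mmul_Mb_left[OF assms(1,2)] mmul_Mb_right[OF assms(1,2)]
    unfolding Mb_def Emat_of_bool e cj_cj[OF assms(3)] cj_cj[OF assms(4)]
    by (simp only: algebra_simps)
qed

text \<open>Multiplication by \<open>Jmat n\<close> merely permutes rows or columns by
  \<open>cj\<close>, so the matrix equation becomes a relation between pairs of entries.\<close>

lemma so_iff:
  "A \<in> so n \<longleftrightarrow> (\<forall>i j. 2*n \<le> i \<or> 2*n \<le> j \<longrightarrow> A i j = 0) \<and>
     (\<forall>a<2*n. \<forall>b<2*n. A (cj n a) (cj n b) = - A b a)"
proof -
  have 1: "mmul n (\<lambda>a b. A b a) (Jmat n) i j = A (cj n j) i" if "i < 2*n" "j < 2*n" for i j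
  proof -
    have "mmul n (\<lambda>a b. A b a) (Jmat n) i j = (\<Sum>k<2*n. if k = cj n j then A k i else 0)"
      unfolding mmul_def using that by (intro sum.cong) (auto simp: Jmat_def cj_def)
    then show ?thesis using cj_less[OF that(2)] by simp
  qed
  have 2: "mmul n (Jmat n) A i j = A (cj n i) j" if "i < 2*n" "j < 2*n" for i j
  proof -
    have "mmul n (Jmat n) A i j = (\<Sum>k<2*n. if k = cj n i then A k j else 0)"
      unfolding mmul_def using that by (intro sum.cong) (auto simp: Jmat_def cj_def)
    then show ?thesis using cj_less[OF that(1)] by simp
  qed
  have "(\<forall>i<2*n. \<forall>j<2*n. A (cj n j) i + A (cj n i) j = 0) \<longleftrightarrow>
     (\<forall>a<2*n. \<forall>b<2*n. A (cj n a) (cj n b) = - A b a)"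
  proof (intro iffI allI impI)
    fix a b assume *: "\<forall>i<2*n. \<forall>j<2*n. A (cj n j) i + A (cj n i) j = 0" "a < 2*n" "b < 2*n"
    then have "A (cj n a) (cj n b) + A (cj n (cj n b)) a = 0" using cj_less by blast
    then show "A (cj n a) (cj n b) = - A b a" using *(3) by (simp add: cj_cj eq_neg_iff_add_eq_0)
  next
    fix i j assume *: "\<forall>a<2*n. \<forall>b<2*n. A (cj n a) (cj n b) = - A b a" "i < 2*n" "j < 2*n"
    then have "A (cj n j) (cj n (cj n i)) = - A (cj n i) j" using cj_less by blast
    then show "A (cj n j) i + A (cj n i) j = 0" using *(2) by (simp add: cj_cj)
  qed
  then show ?thesis unfolding so_def by (simp add: 1 2)
qed

lemma so_zero: "A \<in> so n \<Longrightarrow> 2*n \<le> i \<or> 2*n \<le> j \<Longrightarrow> A i j = 0"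
  unfolding so_iff by blast

lemma so_cj: "A \<in> so n \<Longrightarrow> a < 2*n \<Longrightarrow> b < 2*n \<Longrightarrow> A (cj n a) (cj n b) = - A b a"
  unfolding so_iff by blast

lemma Mb_so:
  assumes "a < 2*n" "b < 2*n"
  shows "Mb n a b \<in> so n"
  unfolding so_iff
proof (intro conjI allI impI)
  fix x y assume "2*n \<le> x \<or> 2*n \<le> y"
  then have "\<not> (x = a \<and> y = b)" "\<not> (x = cj n b \<and> y = cj n a)"
    using assms cj_less[OF assms(1)] cj_less[OF assms(2)] by (metis not_le)+
  then show "Mb n a b x y = 0" unfolding Mb_def Emat_def by (simp only: if_False diff_self)
next
  fix x y assume xy: "x < 2*n" "y < 2*n"
  have e: "(cj n x = a) = (x = cj n a)" "(cj n x = cj n b) = (x = b)"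
    "(cj n y = b) = (y = cj n b)" "(cj n y = cj n a) = (y = a)"
    using xy assms by (auto simp: cj_cj cj_eq_iff)
  show "Mb n a b (cj n x) (cj n y) = - Mb n a b y x"
    unfolding Mb_def Emat_of_bool e by (simp only: mult.commute minus_diff_eq)
qed

lemma so_add: "A \<in> so n \<Longrightarrow> B \<in> so n \<Longrightarrow> (\<lambda>a b. A a b + B a b) \<in> so n"
  unfolding so_iff by simp

lemma so_msc: "A \<in> so n \<Longrightarrow> msc c A \<in> so n"
  unfolding so_iff msc_def by simp

lemma so_0: "(\<lambda>a b. 0) \<in> so n"
  unfolding so_iff by simp

lemma so_sum: "(\<And>k. k \<in> S \<Longrightarrow> A k \<in> so n) \<Longrightarrow> (\<lambda>a b. \<Sum>k\<in>S. c k * A k a b) \<in> so n"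
  unfolding so_iff by (simp add: sum_negf)

lemma so_brk:
  assumes "A \<in> so n" "B \<in> so n"
  shows "brk n A B \<in> so n"
proof -
  have *: "mmul n A B (cj n a) (cj n b) = mmul n B A b a"
    if "a < 2*n" "b < 2*n" "A \<in> so n" "B \<in> so n" for a b A B
  proof -
    have "mmul n A B (cj n a) (cj n b) = (\<Sum>k<2*n. A (cj n a) (cj n k) * B (cj n k) (cj n b))"
      unfolding mmul_def by (rule sum.reindex_bij_betw[OF bij_betw_cj, symmetric])
    also have "\<dots> = mmul n B A b a"
      unfolding mmul_def using that by (intro sum.cong) (auto simp: so_cj)
    finally show ?thesis .
  qed
  show ?thesis
    unfolding so_iff using assms
    by (auto simp: brk_def *) (auto simp: mmul_def so_zero)
qed

lemma brk_lin_left: "brk n (\<lambda>x y. c * A x y + d * B x y) C = (\<lambda>x y. c * brk n A C x y + d * brk n B C x y)"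
  by (intro ext) (simp add: brk_def mmul_lin_left mmul_lin_right algebra_simps)

lemma brk_lin_right: "brk n C (\<lambda>x y. c * A x y + d * B x y) = (\<lambda>x y. c * brk n C A x y + d * brk n C B x y)"
  by (intro ext) (simp add: brk_def mmul_lin_left mmul_lin_right algebra_simps)

lemma brk_add_left: "brk n (\<lambda>x y. A x y + B x y) C = (\<lambda>x y. brk n A C x y + brk n B C x y)"
  using brk_lin_left[of n 1 A 1 B C] by simp

lemma brk_add_right: "brk n C (\<lambda>x y. A x y + B x y) = (\<lambda>x y. brk n C A x y + brk n C B x y)"
  using brk_lin_right[of n C 1 A 1 B] by simp

lemma brk_msc_left: "brk n (msc c A) C = msc c (brk n A C)"
  using brk_lin_left[of n c A 0 A C] by (simp add: msc_def)

lemma brk_msc_right: "brk n C (msc c A) = msc c (brk n C A)"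
  using brk_lin_right[of n C c A 0 A] by (simp add: msc_def)

lemma brk_sum_right: "brk n C (\<lambda>x y. \<Sum>k\<in>S. c k * A k x y) = (\<lambda>x y. \<Sum>k\<in>S. c k * brk n C (A k) x y)"
proof (induction S rule: infinite_finite_induct)
  case (insert k S)
  then show ?case using brk_lin_right[of n C "c k" "A k" 1 "\<lambda>x y. \<Sum>k\<in>S. c k * A k x y"] by simp
qed (auto simp: brk_def mmul_def)

lemma gpart_brk:
  assumes A: "A \<in> gpart n P" and B: "B \<in> gpart n Q" and PQ: "\<And>d e. P d \<Longrightarrow> Q e \<Longrightarrow> R (d + e)"
  shows "brk n A B \<in> gpart n R"
proof -
  have *: "R (hq n a - hq n b)" if "A \<in> gpart n P" "B \<in> gpart n Q" "\<And>d e. P d \<Longrightarrow> Q e \<Longrightarrow> R (d + e)"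
     "mmul n A B a b \<noteq> 0" for A B P Q a b
  proof -
    from that(4) obtain k where "A a k \<noteq> 0" "B k b \<noteq> 0"
      unfolding mmul_def by (metis (no_types, lifting) mult_not_zero sum.neutral)
    then have "P (hq n a - hq n k)" "Q (hq n k - hq n b)"
      using that(1,2) unfolding gpart_def by auto
    from that(3)[OF this] show ?thesis by simp
  qed
  have "R (hq n a - hq n b)" if "brk n A B a b \<noteq> 0" for a b
  proof -
    from that have "mmul n A B a b \<noteq> 0 \<or> mmul n B A a b \<noteq> 0" by (auto simp: brk_def)
    then show ?thesis using *[OF A B PQ] *[OF B A] PQ by (metis add.commute)
  qed
  then show ?thesis using A B so_brk unfolding gpart_def by auto
qed

lemma hq_cj: "a < 2 * n \<Longrightarrow> 2 \<le> n \<Longrightarrow> hq n (cj n a) = - hq n a"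
  by (auto simp: hq_def cj_def)

lemma Mb_gpart:
  assumes "a < 2*n" "b < 2*n" "2 \<le> n" "P (hq n a - hq n b)"
  shows "Mb n a b \<in> gpart n P"
  using assms Mb_so[OF assms(1,2)] unfolding gpart_def
  by (auto simp: Mb_def Emat_def hq_cj split: if_splits)

text \<open>The indices of the 4-dimensional middle block \<open>V\<close>.\<close>

definition Qs :: "nat \<Rightarrow> nat set" where
  "Qs n = {n-2, n-1, n+(n-2), n+(n-1)}"

lemma finite_Qs: "finite (Qs n)" by (simp add: Qs_def)

lemma card_Qs: "2 \<le> n \<Longrightarrow> card (Qs n) = 4"
proof -
  assume "2 \<le> n"
  then have "n-2 \<noteq> n-1" "n-2 \<noteq> n+(n-2)" "n-2 \<noteq> n+(n-1)" "n-1 \<noteq> n+(n-2)" "n-1 \<noteq> n+(n-1)" "n+(n-2) \<noteq> n+(n-1)"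
    by linarith+
  moreover have "card {a, b, c, d} = 4" if "a \<noteq> b" "a \<noteq> c" "a \<noteq> d" "b \<noteq> c" "b \<noteq> d" "c \<noteq> d" for a b c d :: nat
    using that by simp
  ultimately show ?thesis unfolding Qs_def by blast
qed

lemma Qs_cj: "2 \<le> n \<Longrightarrow> p \<in> Qs n \<Longrightarrow> cj n p \<in> Qs n"
  by (auto simp: Qs_def cj_def)

lemma Qs_less: "2 \<le> n \<Longrightarrow> p \<in> Qs n \<Longrightarrow> p < 2 * n"
  by (auto simp: Qs_def)

lemma Qs_iff: "2 \<le> n \<Longrightarrow> p \<in> Qs n \<longleftrightarrow> (n - 2 \<le> p \<and> p < n) \<or> (2*n - 2 \<le> p \<and> p < 2*n)"
  by (auto simp: Qs_def)

lemma hq_Qs: "2 \<le> n \<Longrightarrow> p \<in> Qs n \<Longrightarrow> hq n p = 0"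
  by (auto simp: Qs_iff hq_def)

lemma Qs_neq: "2 \<le> n \<Longrightarrow> p \<in> Qs n \<Longrightarrow> i < n - 2 \<Longrightarrow> p \<noteq> i \<and> p \<noteq> i + n \<and> p \<noteq> n + i"
  by (auto simp: Qs_iff)

section \<open>The quadratic forms on g(1)\<close>

lemma zbar_support:
  assumes "D \<in> zbar n" "D x y \<noteq> 0"
  shows "n \<le> x" "x < 2*n - 2" "y < n - 2"
proof -
  have "hq n x - hq n y = -2" using assms unfolding zbar_def gpart_def by blast
  then show "n \<le> x" "x < 2*n - 2" "y < n - 2" by (auto simp: hq_def split: if_splits)
qed

lemma zbar_so: "D \<in> zbar n \<Longrightarrow> D \<in> so n"
  unfolding zbar_def gpart_def by simp

lemma lev_so: "D \<in> lev n \<Longrightarrow> D \<in> so n"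
  unfolding lev_def gpart_def by simp

lemma zbar_antisym:
  assumes "D \<in> zbar n" "i < n" "j < n"
  shows "D (n + i) j = - D (n + j) i"
  using so_cj[OF zbar_so[OF assms(1)], of i "n + j"] assms(2,3) by (simp add: cj_def add.commute)

lemma finite_zidx: "finite (zidx n)"
  by (rule finite_subset[of _ "{..<n} \<times> {..<n}"]) (auto simp: zidx_def)

lemma zbar_decomp:
  assumes D: "D \<in> zbar n"
  shows "(\<lambda>x y. \<Sum>\<gamma>\<in>zidx n. D (n + snd \<gamma>) (fst \<gamma>) * Mb n (n + snd \<gamma>) (fst \<gamma>) x y) = D"
proof (intro ext)
  fix x y
  \<comment> \<open>Each basis vector has two nonzero entries, so for fixed \<open>x\<close> and
    \<open>y\<close> at most one index of each kind contributes. Subtraction truncates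
    \<open>x - n\<close> to 0 when \<open>x < n\<close>, whence the guard
    \<open>n \<le> x\<close>.\<close>
  have "(\<Sum>\<gamma>\<in>zidx n. D (n + snd \<gamma>) (fst \<gamma>) * Mb n (n + snd \<gamma>) (fst \<gamma>) x y)
     = (\<Sum>\<gamma>\<in>zidx n. (if \<gamma> = (y, x - n) then (if n \<le> x then D x y else 0) else 0)
          - (if \<gamma> = (x - n, y) then (if n \<le> x then D (n + y) (x - n) else 0) else 0))"
  proof (intro sum.cong refl)
    fix \<gamma> assume "\<gamma> \<in> zidx n"
    then obtain j k where g: "\<gamma> = (j, k)" "j < k" "k < n - 2" by (auto simp: zidx_def)
    have cj: "cj n (n + k) = k" "cj n j = n + j" using g by (auto simp: cj_def)
    have 1: "(if \<gamma> = (y, x - n) then (if n \<le> x then D x y else 0) else 0)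
        = D (n + k) j * of_bool (x = n + k \<and> y = j)"
      using g(1) by (cases "x = n + k \<and> y = j") auto
    have 2: "(if \<gamma> = (x - n, y) then (if n \<le> x then D (n + y) (x - n) else 0) else 0)
        = D (n + k) j * of_bool (x = n + j \<and> y = k)"
      using g(1) by (cases "x = n + j \<and> y = k") auto
    show "D (n + snd \<gamma>) (fst \<gamma>) * Mb n (n + snd \<gamma>) (fst \<gamma>) x y
      = (if \<gamma> = (y, x - n) then (if n \<le> x then D x y else 0) else 0)
          - (if \<gamma> = (x - n, y) then (if n \<le> x then D (n + y) (x - n) else 0) else 0)"
      unfolding 1 2 by (simp only: g(1) Mb_def Emat_def cj fst_conv snd_conv of_bool_def right_diff_distrib)
  qed
  also have "\<dots> = (if n \<le> x \<and> (y, x - n) \<in> zidx n then D x y else 0)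
      - (if n \<le> x \<and> (x - n, y) \<in> zidx n then D (n + y) (x - n) else 0)"
    by (simp add: sum_subtractf finite_zidx)
  also have "\<dots> = D x y"
  proof -
    consider "n \<le> x" "(y, x - n) \<in> zidx n" | "n \<le> x" "(x - n, y) \<in> zidx n"
      | "\<not> (n \<le> x \<and> (y, x - n) \<in> zidx n)" "\<not> (n \<le> x \<and> (x - n, y) \<in> zidx n)" by blast
    then show ?thesis
    proof cases
      case 1 then show ?thesis by (auto simp: zidx_def)
    next
      case 2
      then have "D (n + y) (x - n) = - D x y"
        using zbar_antisym[OF D, of y "x - n"] by (auto simp: zidx_def)
      then show ?thesis using 2 by (auto simp: zidx_def)
    next
      case 3
      have "D x y = 0"
      proof (rule ccontr)
        assume nz: "D x y \<noteq> 0"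
        note z = zbar_support[OF D nz]
        \<comment> \<open>Off the support of the basis only the positions \<open>x = n + y\<close>
          are left, and there antisymmetry forces the entry to be 0.\<close>
        then have "x = n + y" using 3 by (auto simp: zidx_def)
        then show False using zbar_antisym[OF D, of y y] z nz by simp
      qed
      then show ?thesis using 3 by auto
    qed
  qed
  finally show "(\<Sum>\<gamma>\<in>zidx n. D (n + snd \<gamma>) (fst \<gamma>) * Mb n (n + snd \<gamma>) (fst \<gamma>) x y) = D x y" .
qed

section \<open>The trace form and the polarized quadratic forms\<close>

definition trp :: "nat \<Rightarrow> cmat \<Rightarrow> cmat \<Rightarrow> complex" where
  "trp n A B = (\<Sum>a<2*n. \<Sum>b<2*n. A a b * B b a)"

lemma trp_add: "trp n C (\<lambda>x y. A x y + B x y) = trp n C A + trp n C B"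
  by (simp add: trp_def sum.distrib distrib_left)

lemma trp_diff: "trp n C (\<lambda>x y. A x y - B x y) = trp n C A - trp n C B"
  by (simp add: trp_def sum_subtractf right_diff_distrib)

lemma trp_msc: "trp n C (msc c A) = c * trp n C A"
  by (simp add: trp_def msc_def sum_distrib_left mult_ac)

lemma trp_sum: "trp n C (\<lambda>x y. \<Sum>k\<in>S. c k * A k x y) = (\<Sum>k\<in>S. c k * trp n C (A k))"
proof (induction S rule: infinite_finite_induct)
  case (insert k S)
  then show ?case
    using trp_add[of n C "msc (c k) (A k)" "\<lambda>x y. \<Sum>k\<in>S. c k * A k x y"] trp_msc[of n C "c k" "A k"]
    by (simp add: msc_def)
qed (auto simp: trp_def)

lemma trp_commute: "trp n A B = trp n B A"
  unfolding trp_def by (subst sum.swap) (simp add: mult.commute)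

lemma trp_mmul: "trp n A (mmul n B C) = trp n (mmul n A B) C"
proof -
  have *: "trp n A B = mtr n (mmul n A B)" for A B
    by (simp add: trp_def mtr_def mmul_def)
  show ?thesis by (simp add: * mmul_assoc)
qed

text \<open>Invariance of the trace form, arranged to isolate \<open>A\<close>: for a root vector
  \<open>A\<close>, \<open>trp_Mb\<close> then reads off one matrix entry in place of a trace of
  nested brackets.\<close>

lemma trp_brk: "trp n C (brk n A W) = trp n (brk n W C) A"
proof -
  have "trp n C (brk n A W) = trp n C (mmul n A W) - trp n C (mmul n W A)"
    unfolding brk_def by (rule trp_diff)
  also have "trp n C (mmul n A W) = trp n A (mmul n W C)"
    by (metis trp_mmul trp_commute)
  also have "trp n C (mmul n W A) = trp n A (mmul n C W)"
    by (metis trp_mmul trp_commute)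
  also have "trp n A (mmul n W C) - trp n A (mmul n C W) = trp n A (brk n W C)"
    unfolding brk_def by (rule trp_diff[symmetric])
  finally show ?thesis by (simp add: trp_commute)
qed

lemma trp_Mb:
  assumes "D \<in> so n" "a < 2*n" "b < 2*n"
  shows "trp n D (Mb n a b) = 2 * D b a"
proof -
  have "trp n D (Mb n a b) = (\<Sum>c<2*n. mmul n D (Mb n a b) c c)"
    by (simp add: trp_def mmul_def)
  also have "\<dots> = (\<Sum>c<2*n. (if c = b then D c a else 0) - (if c = cj n a then D c (cj n b) else 0))"
    using assms by (intro sum.cong) (auto simp: mmul_Mb_right)
  also have "\<dots> = D b a - D (cj n a) (cj n b)"
    using assms by (simp add: sum_subtractf cj_less)
  finally show ?thesis using so_cj[OF assms] by simp
qed

lemma kappa_trp: "kappa n A B = of_nat (2*n-2) * trp n A B"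
  by (simp add: kappa_def mtr_def mmul_def trp_def)

text \<open>For \<open>a = cj n b\<close> both vectors would be zero.\<close>

lemma kappa_Mb:
  assumes "a < 2*n" "b < 2*n" "a \<noteq> cj n b"
  shows "kappa n (Mb n a b) (Mb n b a) = of_nat (2*n-2) * 2"
  using assms trp_Mb[OF Mb_so[OF assms(1,2)] assms(2,1)]
  by (simp add: kappa_trp) (simp add: Mb_def Emat_def)

lemma pairing_add_right:
  "pairing n T (\<lambda>a b c d. U a b c d + V a b c d) = pairing n T U + pairing n T V"
  by (simp add: pairing_def sum.distrib distrib_left)

lemma pairing_add_left:
  "pairing n (\<lambda>a b c d. U a b c d + V a b c d) T = pairing n U T + pairing n V T"
  by (simp add: pairing_def sum.distrib distrib_left distrib_right)

lemma pairing_scale_right: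
  "pairing n T (\<lambda>a b c d. k * U a b c d) = k * pairing n T U"
  by (simp add: pairing_def sum_distrib_left mult_ac)

lemma pairing_scale_left:
  "pairing n (\<lambda>a b c d. k * U a b c d) T = k * pairing n U T"
  by (simp add: pairing_def sum_distrib_left mult_ac)

lemma pairing_sum_right:
  "pairing n T (\<lambda>a b c d. \<Sum>k\<in>S. U k a b c d) = (\<Sum>k\<in>S. pairing n T (U k))"
  by (induction S rule: infinite_finite_induct) (simp_all add: pairing_add_right, simp_all add: pairing_def)

lemma pairing_kron: "pairing n (kron A B) (kron C D) = (of_nat (2*n-2))^2 * (trp n A C * trp n B D)"
proof -
  have "(\<Sum>a<2*n. \<Sum>b<2*n. \<Sum>c<2*n. \<Sum>d<2*n. kron A B a b c d * kron C D b a d c)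
    = (\<Sum>a<2*n. \<Sum>b<2*n. (A a b * C b a) * trp n B D)"
    unfolding kron_def trp_def by (simp add: sum_distrib_left mult_ac)
  then show ?thesis by (simp add: pairing_def trp_def sum_distrib_right)
qed

text \<open>Contracting the second factor of omega with \<open>D\<close> rebuilds \<open>D\<close>
  from a basis and its Killing dual. The constants: the pairing gives the square of
  \<open>2*n-2\<close>, the dual vector the inverse of \<open>(2*n-2) * 2\<close>, and the trace of
  \<open>D\<close> against a root vector a further 2.\<close>

lemma polyY_kron:
  assumes "2 \<le> n" "D \<in> zbar n"
  shows "polyY n (kron C D) X = of_nat (2*n-2) / 2 * trp n C (brk n X (brk n X D))"
proof -
  let ?N = "of_nat (2*n-2) :: complex"
  have N: "?N \<noteq> 0" using assms by simp
  let ?M = "\<lambda>\<gamma>. Mb n (n + snd \<gamma>) (fst \<gamma>)"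
  have "polyY n (kron C D) X = 1/2 * (\<Sum>\<gamma>\<in>zidx n. pairing n (kron C D)
     (kron (brk n X (brk n X (zdual n \<gamma>))) (rv_pp n (fst \<gamma>) (snd \<gamma>))))"
    unfolding polyY_def tau2_def pairing_scale_right pairing_sum_right ..
  also have "\<dots> = 1/2 * (\<Sum>\<gamma>\<in>zidx n. ?N * (D (n + snd \<gamma>) (fst \<gamma>) * trp n C (brk n X (brk n X (?M \<gamma>)))))"
  proof (intro arg_cong2[of _ _ _ _ "(*)"] refl sum.cong)
    fix \<gamma> assume g: "\<gamma> \<in> zidx n"
    then have lt: "fst \<gamma> < n" "snd \<gamma> < n" and ne: "fst \<gamma> \<noteq> snd \<gamma>" by (auto simp: zidx_def)
    have k: "kappa n (?M \<gamma>) (Mb n (fst \<gamma>) (n + snd \<gamma>)) = ?N * 2"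
      using lt ne by (intro kappa_Mb) (auto simp: cj_def)
    have z: "zdual n \<gamma> = msc (1 / (?N * 2)) (?M \<gamma>)"
      using lt k by (cases \<gamma>) (simp add: rv_Mb)
    have t: "trp n D (rv_pp n (fst \<gamma>) (snd \<gamma>)) = 2 * D (n + snd \<gamma>) (fst \<gamma>)"
      using lt by (simp add: rv_Mb trp_Mb[OF zbar_so[OF assms(2)]])
    show "pairing n (kron C D) (kron (brk n X (brk n X (zdual n \<gamma>))) (rv_pp n (fst \<gamma>) (snd \<gamma>)))
       = ?N * (D (n + snd \<gamma>) (fst \<gamma>) * trp n C (brk n X (brk n X (?M \<gamma>))))"
      unfolding pairing_kron t z brk_msc_right trp_msc using N by (simp add: power2_eq_square field_simps)
  qed
  also have "\<dots> = ?N / 2 * trp n C (\<lambda>x y. \<Sum>\<gamma>\<in>zidx n. D (n + snd \<gamma>) (fst \<gamma>) * brk n X (brk n X (?M \<gamma>)) x y)"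
    unfolding trp_sum by (simp only: sum_distrib_left[symmetric]) simp
  also have "(\<lambda>x y. \<Sum>\<gamma>\<in>zidx n. D (n + snd \<gamma>) (fst \<gamma>) * brk n X (brk n X (?M \<gamma>)) x y)
     = brk n X (brk n X D)"
    unfolding brk_sum_right[symmetric] zbar_decomp[OF assms(2)] ..
  finally show ?thesis .
qed

lemma polarB_kron:
  assumes "2 \<le> n" "D \<in> zbar n"
  shows "polarB n (kron C D) X X' = of_nat (2*n-2) / 4 *
     (trp n C (brk n X (brk n X' D)) + trp n C (brk n X' (brk n X D)))"
  unfolding polarB_def polyY_kron[OF assms] brk_add_left brk_add_right trp_add
  by (simp add: algebra_simps)

lemma zbar_Qs:
  assumes "D \<in> zbar n" "2 \<le> n" "q \<in> Qs n"
  shows "D q y = 0" "D x q = 0"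
proof -
  have "\<not> (n \<le> q \<and> q < 2*n - 2)" "\<not> q < n - 2" using assms(2,3) by (auto simp: Qs_iff)
  then show "D q y = 0" "D x q = 0"
    using zbar_support[OF assms(1), of q y] zbar_support[OF assms(1), of x q] by blast+
qed

lemma trp_brk_brk_Mb:
  assumes n: "2 \<le> n" and C: "C \<in> so n" and D: "D \<in> zbar n"
    and ij: "i < n - 2" "j < n - 2" and pq: "p \<in> Qs n" "q \<in> Qs n"
  shows "trp n C (brk n (Mb n i p) (brk n (Mb n j q) D)) =
    2 * (C p (cj n q) * D (n + j) i - of_bool (p = cj n q) * mmul n D C (n + j) i)"
proof -
  have lt: "i < 2*n" "j < 2*n" "p < 2*n" "q < 2*n" "cj n q < 2*n"
    using ij Qs_less[OF n] pq Qs_cj[OF n] by auto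
  have cjj: "cj n j = n + j" using ij by (simp add: cj_def)
  have ne: "i \<noteq> q" using Qs_neq[OF n pq(2) ij(1)] by auto
  let ?W = "brk n (Mb n j q) D"
  have W: "?W x y = - of_bool (x = cj n q) * D (n + j) y - of_bool (y = q) * D x j" for x y
    unfolding brk_def mmul_Mb_left[OF lt(2,4)] mmul_Mb_right[OF lt(2,4)]
    using zbar_Qs[OF D n pq(2)] zbar_Qs[OF D n Qs_cj[OF n pq(2)]] by (simp add: cjj)
  have Wso: "?W \<in> so n" using lt by (intro so_brk Mb_so zbar_so[OF D])
  have "mmul n ?W C p i = (\<Sum>k<2*n. - of_bool (p = cj n q) * (D (n + j) k * C k i))"
    unfolding mmul_def W using zbar_Qs[OF D n pq(1)] by (intro sum.cong) auto
  then have 1: "mmul n ?W C p i = - of_bool (p = cj n q) * mmul n D C (n + j) i"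
    by (simp add: mmul_def sum_negf)
  have "mmul n C ?W p i = (\<Sum>k<2*n. if k = cj n q then - C p k * D (n + j) i else 0)"
    unfolding mmul_def W using ne by (intro sum.cong) auto
  then have 2: "mmul n C ?W p i = - C p (cj n q) * D (n + j) i" using lt by simp
  have "trp n C (brk n (Mb n i p) ?W) = 2 * brk n ?W C p i"
    using trp_brk[of n C "Mb n i p" ?W] trp_Mb[OF so_brk[OF Wso C] lt(1,3)] by simp
  also have "brk n ?W C p i = mmul n ?W C p i - mmul n C ?W p i" by (simp only: brk_def)
  finally show ?thesis unfolding 1 2 by (simp only: mult_minus_left minus_diff_minus minus_diff_eq)
qed

text \<open>The Levi factor is gl(U) + so(V). Since \<open>D\<close> has its columns in
  \<open>U\<close>, the product of \<open>D\<close> and \<open>C\<close> involves only the gl(U)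
  block of \<open>C\<close>, while \<open>C q (cj n p)\<close> is an entry of its so(V) block. The
  two blocks yield the two kinds of forms.\<close>

lemma polarB_kron_Mb:
  assumes n: "2 \<le> n" and C: "C \<in> so n" and D: "D \<in> zbar n"
    and ij: "i < n - 2" "j < n - 2" and pq: "p \<in> Qs n" "q \<in> Qs n"
  shows "polarB n (kron C D) (Mb n i p) (Mb n j q) =
    of_bool (q = cj n p) * (- of_nat (2*n-2) / 2 * (mmul n D C (n + i) j + mmul n D C (n + j) i))
    + of_nat (2*n-2) * (C q (cj n p) * D (n + i) j)"
proof -
  have lt: "p < 2*n" "q < 2*n" using Qs_less[OF n] pq by auto
  have 1: "C p (cj n q) = - C q (cj n p)"
    using so_cj[OF C, of "cj n p" q] lt by (simp add: cj_less cj_cj)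
  have 2: "D (n + j) i = - D (n + i) j" using zbar_antisym[OF D, of j i] ij by simp
  have 3: "p = cj n q \<longleftrightarrow> q = cj n p" using lt by (auto simp: cj_cj)
  show ?thesis
    unfolding polarB_kron[OF n D] trp_brk_brk_Mb[OF n C D ij pq]
      trp_brk_brk_Mb[OF n C D ij(2,1) pq(2,1)] 1 2 3
    by (simp add: field_simps)
qed

lemma polarB_add: "polarB n (\<lambda>a b c d. T a b c d + U a b c d) X X' = polarB n T X X' + polarB n U X X'"
  by (simp add: polarB_def polyY_def pairing_add_left field_simps)

lemma polarB_scale: "polarB n (\<lambda>a b c d. k * T a b c d) X X' = k * polarB n T X X'"
  by (simp add: polarB_def polyY_def pairing_scale_left field_simps)

lemma polarB_zero: "polarB n (\<lambda>a b c d. 0) X X' = 0"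
  using polarB_scale[of n 0 "\<lambda>a b c d. 0" X X'] by simp

lemma polarB_sum: "polarB n (\<lambda>a b c d. \<Sum>k\<in>S. T k a b c d) X X' = (\<Sum>k\<in>S. polarB n (T k) X X')"
  by (induction S rule: infinite_finite_induct) (simp_all add: polarB_add polarB_zero)

text \<open>\<open>S\<close> is the component in $Sym^2 U^*$ times the invariant form of \<open>V\<close>, and \<open>K\<close> that in $\Lambda^2 U^* \otimes \Lambda^2 V$.\<close>

definition splits :: "nat \<Rightarrow> (nat \<Rightarrow> nat \<Rightarrow> nat \<Rightarrow> nat \<Rightarrow> complex) \<Rightarrow>
    (nat \<Rightarrow> nat \<Rightarrow> complex) \<Rightarrow> arr4 \<Rightarrow> bool" where
  "splits n B S K \<longleftrightarrow> (\<forall>i<n-2. \<forall>j<n-2. \<forall>p\<in>Qs n. \<forall>q\<in>Qs n.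
     B i p j q = of_bool (q = cj n p) * S i j + K i j p q \<and> S j i = S i j \<and>
     K j i p q = - K i j p q \<and> K i j q p = - K i j p q)"

lemma splits_linear:
  assumes "splits n B S K" "splits n B' S' K'"
  shows "splits n (\<lambda>i p j q. c * B i p j q + d * B' i p j q) (\<lambda>i j. c * S i j + d * S' i j)
     (\<lambda>i j p q. c * K i j p q + d * K' i j p q)"
  unfolding splits_def
proof (intro allI ballI impI)
  fix i j p q assume a: "i < n - 2" "j < n - 2" "p \<in> Qs n" "q \<in> Qs n"
  have b: "B i p j q = of_bool (q = cj n p) * S i j + K i j p q" "S j i = S i j"
     "K j i p q = - K i j p q" "K i j q p = - K i j p q"
    using assms(1) a unfolding splits_def by blast+
  have b': "B' i p j q = of_bool (q = cj n p) * S' i j + K' i j p q" "S' j i = S' i j"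
     "K' j i p q = - K' i j p q" "K' i j q p = - K' i j p q"
    using assms(2) a unfolding splits_def by blast+
  show "c * B i p j q + d * B' i p j q = of_bool (q = cj n p) * (c * S i j + d * S' i j) + (c * K i j p q + d * K' i j p q) \<and>
    c * S j i + d * S' j i = c * S i j + d * S' i j \<and>
    c * K j i p q + d * K' j i p q = - (c * K i j p q + d * K' i j p q) \<and>
    c * K i j q p + d * K' i j q p = - (c * K i j p q + d * K' i j p q)"
    unfolding b b' by (simp add: algebra_simps)
qed

text \<open>The symmetries of \<open>K\<close> are the antisymmetry of \<open>D\<close> and that of
  the so(V) block of \<open>C\<close>. They survive linear combinations, so pure tensors decide.
  Mere existence of \<open>S\<close> and \<open>K\<close> suffices, because the contraction below
  uses just these symmetries.\<close>

lemma polarB_splits: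
  assumes n: "2 \<le> n" and "Y \<in> LZbar n"
  shows "\<exists>S K. splits n (\<lambda>i p j q. polarB n Y (Mb n i p) (Mb n j q)) S K"
  using assms(2)
proof induction
  case (gen C D)
  note C = lev_so[OF gen(1)] and D = gen(2)
  have C': "C p (cj n q) = - C q (cj n p)" if "p \<in> Qs n" "q \<in> Qs n" for p q
    using so_cj[OF C, of "cj n p" q] Qs_less[OF n that(1)] Qs_less[OF n that(2)]
    by (simp add: cj_less cj_cj)
  have D': "D (n + j) i = - D (n + i) j" if "i < n - 2" "j < n - 2" for i j
    using zbar_antisym[OF D, of j i] that by simp
  show ?case
  proof (intro exI)
    show "splits n (\<lambda>i p j q. polarB n (kron C D) (Mb n i p) (Mb n j q))
      (\<lambda>i j. - of_nat (2*n-2) / 2 * (mmul n D C (n + i) j + mmul n D C (n + j) i))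
      (\<lambda>i j p q. of_nat (2*n-2) * (C q (cj n p) * D (n + i) j))"
      unfolding splits_def
    proof (intro allI ballI impI conjI)
      fix i j p q assume a: "i < n - 2" "j < n - 2" "p \<in> Qs n" "q \<in> Qs n"
      show "polarB n (kron C D) (Mb n i p) (Mb n j q) =
        of_bool (q = cj n p) * (- of_nat (2*n-2) / 2 * (mmul n D C (n + i) j + mmul n D C (n + j) i))
        + of_nat (2*n-2) * (C q (cj n p) * D (n + i) j)"
        by (rule polarB_kron_Mb[OF n C D a])
      show "of_nat (2*n-2) * (C q (cj n p) * D (n + j) i) = - (of_nat (2*n-2) * (C q (cj n p) * D (n + i) j))"
        unfolding D'[OF a(1,2)] by simp
      show "of_nat (2*n-2) * (C p (cj n q) * D (n + i) j) = - (of_nat (2*n-2) * (C q (cj n p) * D (n + i) j))"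
        unfolding C'[OF a(3,4)] by simp
    qed (simp only: add.commute)
  qed
next
  case zero
  show ?case by (rule exI[of _ "\<lambda>i j. 0"], rule exI[of _ "\<lambda>i j p q. 0"]) (simp add: splits_def polarB_zero)
next
  case (add T T')
  then obtain S K S' K' where "splits n (\<lambda>i p j q. polarB n T (Mb n i p) (Mb n j q)) S K"
    "splits n (\<lambda>i p j q. polarB n T' (Mb n i p) (Mb n j q)) S' K'" by blast
  from splits_linear[OF this, of 1 1] show ?case unfolding polarB_add mult_1 by blast
next
  case (scl T k)
  then obtain S K where "splits n (\<lambda>i p j q. polarB n T (Mb n i p) (Mb n j q)) S K" by blast
  from splits_linear[OF this this, of k 0] show ?case
    unfolding polarB_scale mult_zero_left add_0_right by blast
qed

section \<open>Computation modulo the relations of the module\<close>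

definition keq :: "nat \<Rightarrow> complex \<Rightarrow> fvec \<Rightarrow> fvec \<Rightarrow> bool" where
  "keq n s f g \<longleftrightarrow> (\<lambda>v. f v - g v) \<in> Kid n s"

lemma keq_refl: "keq n s f f"
  unfolding keq_def using Kid.zero by simp

lemma keq_sym: "keq n s f g \<Longrightarrow> keq n s g f"
  unfolding keq_def using Kid.scl[of "\<lambda>v. f v - g v" n s "-1"] by simp

lemma keq_trans: "keq n s f g \<Longrightarrow> keq n s g h \<Longrightarrow> keq n s f h"
  unfolding keq_def using Kid.add[of "\<lambda>v. f v - g v" n s "\<lambda>v. g v - h v"] by simp

lemma keq_add: "keq n s f g \<Longrightarrow> keq n s f' g' \<Longrightarrow> keq n s (\<lambda>v. f v + f' v) (\<lambda>v. g v + g' v)"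
  unfolding keq_def
  using Kid.add[of "\<lambda>v. f v - g v" n s "\<lambda>v. f' v - g' v"] by (simp add: algebra_simps)

lemma keq_scale: "keq n s f g \<Longrightarrow> keq n s (\<lambda>v. c * f v) (\<lambda>v. c * g v)"
  unfolding keq_def
  using Kid.scl[of "\<lambda>v. f v - g v" n s c] by (simp add: algebra_simps)

lemma keq_sum:
  assumes "\<And>k. k \<in> S \<Longrightarrow> keq n s (f k) (g k)"
  shows "keq n s (\<lambda>v. \<Sum>k\<in>S. f k v) (\<lambda>v. \<Sum>k\<in>S. g k v)"
  using assms by (induction S rule: infinite_finite_induct) (auto simp: keq_refl keq_add)

lemma keq_Kid: "keq n s f g \<Longrightarrow> f \<in> Kid n s \<longleftrightarrow> g \<in> Kid n s"
  using keq_trans[of n s f g "\<lambda>v. 0"] keq_trans[of n s g f "\<lambda>v. 0"] keq_sym[of n s f g]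
  by (auto simp: keq_def)

lemma keq_letter_zero:
  assumes "set u \<subseteq> so n" "set w \<subseteq> so n"
  shows "keq n s (wd (u @ [\<lambda>a b. 0] @ w)) (\<lambda>v. 0)"
  using Kid.lin_scl[OF assms so_0, of 0 s] by (simp add: keq_def msc_def)

lemma keq_letter_sum:
  assumes "set u \<subseteq> so n" "set w \<subseteq> so n" "finite S" "\<And>k. k \<in> S \<Longrightarrow> x k \<in> so n"
  shows "keq n s (wd (u @ [\<lambda>a b. \<Sum>k\<in>S. c k * x k a b] @ w)) (\<lambda>v. \<Sum>k\<in>S. c k * wd (u @ [x k] @ w) v)"
  using assms(3,4)
proof (induction S rule: finite_induct)
  case empty
  show ?case using keq_letter_zero[OF assms(1,2)] by simp
next
  case (insert k S)
  let ?r = "\<lambda>a b. \<Sum>k\<in>S. c k * x k a b"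
  have so: "x k \<in> so n" "?r \<in> so n" using insert.prems by (auto intro!: so_sum)
  have 1: "keq n s (wd (u @ [\<lambda>a b. msc (c k) (x k) a b + ?r a b] @ w))
     (\<lambda>v. wd (u @ [msc (c k) (x k)] @ w) v + wd (u @ [?r] @ w) v)"
    using Kid.lin_add[OF assms(1,2) so_msc[OF so(1)] so(2), of "c k" s] by (simp add: keq_def algebra_simps)
  have 2: "keq n s (wd (u @ [msc (c k) (x k)] @ w)) (\<lambda>v. c k * wd (u @ [x k] @ w) v)"
    using Kid.lin_scl[OF assms(1,2) so(1), of "c k" s] by (simp add: keq_def)
  have 3: "keq n s (wd (u @ [?r] @ w)) (\<lambda>v. \<Sum>k\<in>S. c k * wd (u @ [x k] @ w) v)"
    using insert by blast
  from keq_trans[OF 1 keq_add[OF 2 3]] show ?case using insert.hyps by (simp add: msc_def)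
qed

text \<open>\<open>X\<close> is commuted to the right end, where it acts by 0. The brackets with
  \<open>a\<close> and \<open>b\<close> lie in q as well: the one with \<open>b\<close> is already
  last and acts as a scalar, the one with \<open>a\<close> must still pass \<open>b\<close>, which
  produces the double bracket.\<close>

lemma keq_three_letters:
  assumes so: "X \<in> so n" "a \<in> so n" "b \<in> so n" and q: "X \<in> qpar n" "brk n X a \<in> qpar n" "brk n X b \<in> qpar n"
    and chi: "chi n s X = 0"
  shows "keq n s (wd [X, a, b]) (\<lambda>v. chi n s (brk n X b) * wd [a] v + chi n s (brk n X a) * wd [b] v
     + wd [brk n (brk n X a) b] v)"
proof -
  have Xa: "brk n X a \<in> so n" by (intro so_brk so)
  have 1: "(\<lambda>v. wd [X,a,b] v - wd [a,X,b] v - wd [brk n X a, b] v) \<in> Kid n s"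
    using Kid.comm[of "[]" n "[b]" X a s] so by simp
  have 2: "(\<lambda>v. wd [a,X,b] v - wd [a,b,X] v - wd [a, brk n X b] v) \<in> Kid n s"
    using Kid.comm[of "[a]" n "[]" X b s] so by simp
  have 3: "(\<lambda>v. wd [a,b,X] v) \<in> Kid n s"
    using Kid.par[of "[a,b]" n X s] so q chi by simp
  have 4: "(\<lambda>v. wd [a, brk n X b] v - chi n s (brk n X b) * wd [a] v) \<in> Kid n s"
    using Kid.par[of "[a]" n "brk n X b" s] so q by simp
  have 5: "(\<lambda>v. wd [brk n X a, b] v - wd [b, brk n X a] v - wd [brk n (brk n X a) b] v) \<in> Kid n s"
    using Kid.comm[of "[]" n "[]" "brk n X a" b s] so Xa by simp
  have 6: "(\<lambda>v. wd [b, brk n X a] v - chi n s (brk n X a) * wd [b] v) \<in> Kid n s"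
    using Kid.par[of "[b]" n "brk n X a" s] so q by simp
  show ?thesis
    unfolding keq_def
    using Kid.add[OF Kid.add[OF Kid.add[OF 1 2] Kid.add[OF 3 4]] Kid.add[OF 5 6]]
    by (simp add: algebra_simps)
qed

lemma lmul_wd: "lmul X (wd w) = wd (X # w)"
  by (auto simp: lmul_def wd_def split: list.splits)

lemma lmul_add: "lmul X (\<lambda>v. f v + g v) = (\<lambda>v. lmul X f v + lmul X g v)"
  by (auto simp: lmul_def split: list.splits)

lemma lmul_diff: "lmul X (\<lambda>v. f v - g v) = (\<lambda>v. lmul X f v - lmul X g v)"
  by (auto simp: lmul_def split: list.splits)

lemma lmul_scale: "lmul X (\<lambda>v. c * f v) = (\<lambda>v. c * lmul X f v)"
  by (auto simp: lmul_def split: list.splits)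

lemma lmul_zero: "lmul X (\<lambda>v. 0) = (\<lambda>v. 0)"
  by (auto simp: lmul_def split: list.splits)

lemma lmul_sum: "lmul X (\<lambda>v. \<Sum>k\<in>S. f k v) = (\<lambda>v. \<Sum>k\<in>S. lmul X (f k) v)"
  by (induction S rule: infinite_finite_induct) (simp_all add: lmul_add lmul_zero)

text \<open>Every generator of \<open>Kid\<close> carries an arbitrary prefix, so one more letter in
  front gives a generator of the same kind. This is what allows commutators of g(1) to reach
  g(2).\<close>

lemma Kid_lmul:
  assumes "f \<in> Kid n s" "X \<in> so n"
  shows "lmul X f \<in> Kid n s"
  using assms(1)
proof induction
  case zero
  then show ?case by (simp add: lmul_zero Kid.zero)
next
  case (add f h)
  then show ?case by (simp add: lmul_add Kid.add)
next
  case (scl f c)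
  then show ?case by (simp add: lmul_scale Kid.scl)
next
  case (lin_add u w x y)
  then show ?case using Kid.lin_add[of "X # u" n w x y s] assms(2) by (simp add: lmul_diff lmul_wd)
next
  case (lin_scl u w x c)
  then show ?case using Kid.lin_scl[of "X # u" n w x c s] assms(2) by (simp add: lmul_diff lmul_scale lmul_wd)
next
  case (comm u w x y)
  then show ?case using Kid.comm[of "X # u" n w x y s] assms(2) by (simp add: lmul_diff lmul_wd)
next
  case (par u z)
  then show ?case using Kid.par[of "X # u" n z s] assms(2) by (simp add: lmul_diff lmul_scale lmul_wd)
qed

section \<open>The contraction identity\<close>

lemma sum_mult_of_bool: "finite S \<Longrightarrow> a \<in> S \<Longrightarrow> (\<Sum>x\<in>S. f x * of_bool (x = a)) = (f a :: complex)"
  by (simp add: of_bool_def if_distrib[of "\<lambda>t. _ * t"] cong: if_cong)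

text \<open>\<open>G p i\<close> stands for a fixed matrix entry of the root vector
  \<open>Mb n p i\<close>; with \<open>G\<close> arbitrary, the statement is pure index calculus.
  The first two of the five terms are the character values, the other three the double
  bracket.\<close>

lemma contraction_sum:
  fixes G :: "nat \<Rightarrow> nat \<Rightarrow> complex"
  assumes n: "2 \<le> n" and spl: "splits n B S K" and k: "k < n - 2" and r: "r \<in> Qs n"
  shows "(\<Sum>i<n-2. \<Sum>p\<in>Qs n. \<Sum>j<n-2. \<Sum>q\<in>Qs n. B i p j q *
      (- s * of_bool (j = k) * of_bool (q = r) * G p i - s * of_bool (i = k) * of_bool (p = r) * G q j
       - of_bool (j = k) * of_bool (p = r) * G q i
       - of_bool (i = k) * of_bool (q = r) * G p j
       + of_bool (i = k) * of_bool (q = cj n p) * G (cj n r) j))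
   = 2 * (1 - s) * (\<Sum>j<n-2. \<Sum>q\<in>Qs n. B k r j q * G q j)" (is "?L = _")
proof -
  let ?I = "{..<n-2}" and ?Q = "Qs n"
  note fQ = finite_Qs[of n]
  have kI: "k \<in> ?I" using k by simp
  have Bd: "B i p j q = of_bool (q = cj n p) * S i j + K i j p q" "S j i = S i j"
     "K j i p q = - K i j p q" "K i j q p = - K i j p q"
    if "i < n-2" "j < n-2" "p \<in> ?Q" "q \<in> ?Q" for i j p q
    using spl that unfolding splits_def by blast+
  have e: "(p = cj n q) = (q = cj n p)" if "p \<in> ?Q" "q \<in> ?Q" for p q
    using Qs_less[OF n that(1)] Qs_less[OF n that(2)] by (auto simp: cj_cj)
  have Bsym: "B j q i p = B i p j q" if "i < n-2" "j < n-2" "p \<in> ?Q" "q \<in> ?Q" for i j p q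
    using Bd[OF that] Bd(1)[OF that(2,1,4,3)] Bd(4)[OF that(2,1,3,4)] e[OF that(3,4)] by simp
  define R where "R = (\<Sum>j\<in>?I. \<Sum>q\<in>?Q. B k r j q * G q j)"
  define T where "T = (\<Sum>j\<in>?I. \<Sum>q\<in>?Q. B j r k q * G q j)"
  define U where "U = (\<Sum>j\<in>?I. S k j * G (cj n r) j)"
  have t1: "(\<Sum>i\<in>?I. \<Sum>p\<in>?Q. \<Sum>j\<in>?I. \<Sum>q\<in>?Q. B i p j q * G p i * of_bool (j = k) * of_bool (q = r)) = R"
    unfolding R_def using k r
    by (simp only: sum_mult_of_bool[OF fQ r] sum_mult_of_bool[OF finite_lessThan kI])
       (intro sum.cong refl, simp add: Bsym)
  have t2: "(\<Sum>i\<in>?I. \<Sum>p\<in>?Q. \<Sum>j\<in>?I. \<Sum>q\<in>?Q. B i p j q * G q j * of_bool (i = k) * of_bool (p = r)) = R"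
    unfolding R_def using k r
    by (simp only: sum_distrib_right[symmetric] sum_mult_of_bool[OF fQ r] sum_mult_of_bool[OF finite_lessThan kI])
  have t3: "(\<Sum>i\<in>?I. \<Sum>p\<in>?Q. \<Sum>j\<in>?I. \<Sum>q\<in>?Q. B i p j q * G q i * of_bool (j = k) * of_bool (p = r)) = T"
    unfolding T_def using k r
    by (simp only: sum_distrib_right[symmetric] sum_mult_of_bool[OF fQ r] sum_mult_of_bool[OF finite_lessThan kI])
  have "(\<Sum>i\<in>?I. \<Sum>p\<in>?Q. \<Sum>j\<in>?I. \<Sum>q\<in>?Q. B i p j q * G p j * of_bool (i = k) * of_bool (q = r))
     = (\<Sum>p\<in>?Q. \<Sum>j\<in>?I. B k p j r * G p j)"
    by (simp only: sum_distrib_right[symmetric] sum_mult_of_bool[OF fQ r] sum_mult_of_bool[OF finite_lessThan kI])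
  also have "\<dots> = T"
    unfolding T_def by (subst sum.swap) (intro sum.cong refl, simp add: Bsym k r)
  finally have t4: "(\<Sum>i\<in>?I. \<Sum>p\<in>?Q. \<Sum>j\<in>?I. \<Sum>q\<in>?Q. B i p j q * G p j * of_bool (i = k) * of_bool (q = r)) = T" .
  have "(\<Sum>i\<in>?I. \<Sum>p\<in>?Q. \<Sum>j\<in>?I. \<Sum>q\<in>?Q. B i p j q * G (cj n r) j * of_bool (i = k) * of_bool (q = cj n p))
     = (\<Sum>i\<in>?I. \<Sum>p\<in>?Q. \<Sum>j\<in>?I. B i p j (cj n p) * G (cj n r) j * of_bool (i = k))"
    by (intro sum.cong refl sum_mult_of_bool[OF fQ] Qs_cj[OF n])
  also have "\<dots> = (\<Sum>p\<in>?Q. \<Sum>j\<in>?I. B k p j (cj n p) * G (cj n r) j)"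
    by (simp only: sum_distrib_right[symmetric] sum_mult_of_bool[OF finite_lessThan kI])
  also have "\<dots> = (\<Sum>j\<in>?I. (\<Sum>p\<in>?Q. B k p j (cj n p)) * G (cj n r) j)"
    by (subst sum.swap) (simp only: sum_distrib_right)
  also have "\<dots> = (\<Sum>j\<in>?I. 4 * (S k j * G (cj n r) j))"
  proof (intro sum.cong refl)
    fix j assume "j \<in> ?I"
    then have j: "j < n - 2" by simp
    \<comment> \<open>\<open>cj\<close> permutes \<open>?Q\<close> and exchanges the last two
      arguments of \<open>K\<close>, which changes the sign. So \<open>K\<close> has trace 0 over
      \<open>V\<close>, and the invariant form contributes \<open>card (Qs n)\<close>, which is
      4.\<close>
    have "(\<Sum>p\<in>?Q. K k j p (cj n p)) = (\<Sum>p\<in>?Q. K k j (cj n p) (cj n (cj n p)))"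
      by (rule sum.reindex_bij_witness[of _ "cj n" "cj n"]) (auto simp: Qs_cj[OF n] cj_cj Qs_less[OF n])
    also have "\<dots> = (\<Sum>p\<in>?Q. - K k j p (cj n p))"
      by (intro sum.cong refl) (simp add: cj_cj Qs_less[OF n] Bd(4)[OF k j _ Qs_cj[OF n]])
    finally have "(\<Sum>p\<in>?Q. K k j p (cj n p)) = 0" by (simp add: sum_negf)
    moreover have "(\<Sum>p\<in>?Q. B k p j (cj n p)) = (\<Sum>p\<in>?Q. S k j + K k j p (cj n p))"
      by (intro sum.cong refl) (simp add: Bd(1)[OF k j _ Qs_cj[OF n]])
    ultimately show "(\<Sum>p\<in>?Q. B k p j (cj n p)) * G (cj n r) j = 4 * (S k j * G (cj n r) j)"
      by (simp add: sum.distrib card_Qs[OF n])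
  qed
  also have "\<dots> = 4 * U" unfolding U_def by (simp only: sum_distrib_left)
  finally have t5: "(\<Sum>i\<in>?I. \<Sum>p\<in>?Q. \<Sum>j\<in>?I. \<Sum>q\<in>?Q. B i p j q * G (cj n r) j * of_bool (i = k) * of_bool (q = cj n p)) = 4 * U" .
  \<comment> \<open>Exchanging the \<open>U\<close>-indices fixes \<open>S\<close> and negates
    \<open>K\<close>: in the sum \<open>K\<close> drops out and \<open>S\<close> doubles.\<close>
  have "R + T = (\<Sum>j\<in>?I. \<Sum>q\<in>?Q. 2 * S k j * G q j * of_bool (q = cj n r))"
    unfolding R_def T_def sum.distrib[symmetric]
  proof (intro sum.cong refl)
    fix j q assume "j \<in> ?I" and q: "q \<in> ?Q"
    then have j: "j < n - 2" by simp
    show "B k r j q * G q j + B j r k q * G q j = 2 * S k j * G q j * of_bool (q = cj n r)"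
      unfolding Bd(1)[OF k j r q] Bd(1)[OF j k r q] Bd(2)[OF k j r q] Bd(3)[OF k j r q]
      by (simp add: algebra_simps)
  qed
  also have "\<dots> = (\<Sum>j\<in>?I. 2 * S k j * G (cj n r) j)"
    by (intro sum.cong refl sum_mult_of_bool[OF fQ] Qs_cj[OF n r])
  also have "\<dots> = 2 * U" unfolding U_def by (simp add: sum_distrib_left mult.assoc)
  finally have RT: "R + T = 2 * U" .
  have ring: "b * (- s * x1 * x2 * g1 - s * x3 * x4 * g2 - x1 * x4 * g3 - x3 * x2 * g4 + x3 * x5 * g5)
    = (- s) * (b * g1 * x1 * x2) + (- s) * (b * g2 * x3 * x4) + (- 1) * (b * g3 * x1 * x4)
      + (- 1) * (b * g4 * x3 * x2) + b * g5 * x3 * x5" for b x1 x2 x3 x4 x5 g1 g2 g3 g4 g5 :: complex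
    by (simp add: algebra_simps)
  have "?L = (\<Sum>i\<in>?I. \<Sum>p\<in>?Q. \<Sum>j\<in>?I. \<Sum>q\<in>?Q.
      (- s) * (B i p j q * G p i * of_bool (j = k) * of_bool (q = r))
      + (- s) * (B i p j q * G q j * of_bool (i = k) * of_bool (p = r))
      + (- 1) * (B i p j q * G q i * of_bool (j = k) * of_bool (p = r))
      + (- 1) * (B i p j q * G p j * of_bool (i = k) * of_bool (q = r))
      + B i p j q * G (cj n r) j * of_bool (i = k) * of_bool (q = cj n p))"
    by (intro sum.cong refl) (rule ring)
  also have "\<dots> = (- s) * R + (- s) * R + (- 1) * T + (- 1) * T + 4 * U"
    by (simp only: sum.distrib sum_distrib_left[symmetric] t1 t2 t3 t4 t5)
  \<comment> \<open>The two copies of \<open>- T\<close> contribute \<open>- 4 * U\<close>, which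
    cancels the trace over \<open>V\<close>.\<close>
  also have "T = 2 * U - R" using RT by (simp add: eq_diff_eq add.commute)
  finally show ?thesis unfolding R_def[symmetric] by (simp add: algebra_simps)
qed

section \<open>Brackets between g(1) and g(-1)\<close>

lemma brk_Mb_grade:
  assumes n: "2 \<le> n" and k: "k < n - 2" and i: "i < n - 2" and r: "r \<in> Qs n" and p: "p \<in> Qs n"
  shows "brk n (Mb n k r) (Mb n p i)
    = (\<lambda>x y. of_bool (p = r) * Mb n k i x y + (- of_bool (i = k)) * Mb n p r x y)"
proof -
  have lt: "k < 2*n" "r < 2*n" "p < 2*n" "i < 2*n" using k i Qs_less[OF n] r p by auto
  have ne: "r \<noteq> cj n i" using Qs_neq[OF n r i] i by (auto simp: cj_def)
  have ne': "cj n p \<noteq> k" using Qs_neq[OF n Qs_cj[OF n p] k] by auto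
  have e: "(r = p) = (p = r)" by auto
  show ?thesis unfolding brk_Mb[OF lt] e using ne ne' by (intro ext) simp
qed

text \<open>The inner bracket has a gl(U) part and an so(V) part. The former changes the
  \<open>U\<close>-index of the last letter. The latter is skew on \<open>V\<close> and gives two
  terms; the one with \<open>q = cj n p\<close> is the source of the trace over
  \<open>V\<close>.\<close>

lemma brk_brk_Mb_grade:
  assumes n: "2 \<le> n" and k: "k < n - 2" and i: "i < n - 2" and j: "j < n - 2"
    and r: "r \<in> Qs n" and p: "p \<in> Qs n" and q: "q \<in> Qs n"
  shows "brk n (brk n (Mb n k r) (Mb n p i)) (Mb n q j) x y =
    - of_bool (j = k) * of_bool (p = r) * Mb n q i x y
    - of_bool (i = k) * of_bool (q = r) * Mb n p j x y
    + of_bool (i = k) * of_bool (q = cj n p) * Mb n (cj n r) j x y"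
proof -
  have lt: "k < 2*n" "r < 2*n" "p < 2*n" "q < 2*n" "i < 2*n" "j < 2*n"
    using k i j Qs_less[OF n] r p q by auto
  have 1: "brk n (Mb n k i) (Mb n q j) x y = - of_bool (j = k) * Mb n q i x y"
  proof -
    have "i \<noteq> q" using Qs_neq[OF n q i] by auto
    moreover have "i \<noteq> cj n j" using i j by (auto simp: cj_def)
    moreover have "cj n q \<noteq> k" using Qs_neq[OF n Qs_cj[OF n q] k] by auto
    ultimately show ?thesis unfolding brk_Mb[OF lt(1,5,4,6)] by simp
  qed
  have 2: "brk n (Mb n p r) (Mb n q j) x y = of_bool (q = r) * Mb n p j x y
      - of_bool (q = cj n p) * Mb n (cj n r) j x y"
  proof -
    have a: "j \<noteq> p" using Qs_neq[OF n p j] by auto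
    have b: "r \<noteq> cj n j" using Qs_neq[OF n r j] j by (auto simp: cj_def)
    have c: "Mb n (cj n j) r x y = - Mb n (cj n r) j x y"
      using Mb_cj[OF cj_less[OF lt(2)] lt(6), of x y] lt(2) by (simp add: cj_cj)
    have d: "(cj n q = p) = (q = cj n p)" "(r = q) = (q = r)" using lt by (auto simp: cj_cj)
    show ?thesis unfolding brk_Mb[OF lt(3,2,4,6)] c d using a b by simp
  qed
  show ?thesis
    unfolding brk_Mb_grade[OF n k i r p] brk_lin_left 1 2 by (simp add: algebra_simps)
qed

lemma chi_brk_Mb:
  assumes n: "2 \<le> n" and k: "k < n - 2" and i: "i < n - 2" and r: "r \<in> Qs n" and p: "p \<in> Qs n"
  shows "chi n s (brk n (Mb n k r) (Mb n p i)) = - s * of_bool (i = k) * of_bool (p = r)"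
proof -
  have 1: "Mb n k i l l = of_bool (l = k) * of_bool (i = k)" if "l < n - 2" for l
    using that i k by (auto simp: Mb_def Emat_def cj_def)
  have 2: "Mb n p r l l = 0" if "l < n - 2" for l
    using Qs_neq[OF n p that] Qs_neq[OF n Qs_cj[OF n r] that] by (auto simp: Mb_def Emat_def)
  have "(\<Sum>l<n-2. brk n (Mb n k r) (Mb n p i) l l)
     = (\<Sum>l<n-2. of_bool (p = r) * of_bool (i = k) * of_bool (l = k))"
    unfolding brk_Mb_grade[OF n k i r p] by (intro sum.cong refl) (simp add: 1 2)
  also have "\<dots> = of_bool (p = r) * of_bool (i = k)"
    using k by (intro sum_mult_of_bool) auto
  finally show ?thesis by (simp add: chi_def)
qed

lemma Mb_qpar:
  assumes "a < 2*n" "b < 2*n" "2 \<le> n" "hq n b \<le> hq n a"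
  shows "Mb n a b \<in> qpar n"
  unfolding qpar_def using assms by (intro Mb_gpart) auto

lemma hq_low: "i < n - 2 \<Longrightarrow> hq n i = 1"
  by (simp add: hq_def)

lemma brk_Mb_qpar:
  assumes n: "2 \<le> n" and k: "k < n - 2" and i: "i < n - 2" and r: "r \<in> Qs n" and p: "p \<in> Qs n"
  shows "brk n (Mb n k r) (msc c (Mb n p i)) \<in> qpar n"
proof -
  have "Mb n k r \<in> gpart n (\<lambda>d. d = 1)" "Mb n p i \<in> gpart n (\<lambda>d. d = -1)"
    using Qs_less[OF n r] Qs_less[OF n p] k i n hq_Qs[OF n r] hq_Qs[OF n p] hq_low[OF k] hq_low[OF i]
    by (auto intro!: Mb_gpart)
  then have "brk n (Mb n k r) (Mb n p i) \<in> gpart n (\<lambda>d. d = 0)"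
    by (rule gpart_brk) auto
  then show ?thesis
    unfolding brk_msc_right using so_msc by (auto simp: qpar_def gpart_def msc_def)
qed

lemma chi_msc: "chi n s (msc c A) = c * chi n s A"
  by (simp add: chi_def msc_def sum_distrib_left mult_ac)

lemma omega2_Mb:
  assumes n: "2 \<le> n"
  shows "omega2 n Y = (\<lambda>v. \<Sum>i<n-2. \<Sum>p\<in>Qs n. \<Sum>j<n-2. \<Sum>q\<in>Qs n.
     polarB n Y (Mb n i p) (Mb n j q) *
     wd [msc (1 / (of_nat (2*n-2) * 2)) (Mb n p i), msc (1 / (of_nat (2*n-2) * 2)) (Mb n q j)] v)"
proof -
  \<comment> \<open>The sign of eps_k in a root of g(1) becomes the choice between \<open>k\<close>
    and its conjugate index \<open>n + k\<close>, so that the roots are indexed by pairs from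
    \<open>U\<close> and \<open>V\<close>.\<close>
  define ix where "ix = (\<lambda>(j::nat, k, b). (j, if b then n + k else k))"
  let ?c = "1 / (of_nat (2*n-2) * 2) :: complex"
  have bij: "bij_betw ix (g1idx n) ({..<n-2} \<times> Qs n)"
    unfolding bij_betw_def
  proof
    show "inj_on ix (g1idx n)"
      using n by (auto simp: inj_on_def ix_def g1idx_def split: if_splits)
    show "ix ` g1idx n = {..<n-2} \<times> Qs n"
      unfolding ix_def g1idx_def Qs_def image_def using n by (auto split: if_splits) force+
  qed
  have e: "e1 n \<beta> = Mb n (fst (ix \<beta>)) (snd (ix \<beta>)) \<and> e1dual n \<beta> = msc ?c (Mb n (snd (ix \<beta>)) (fst (ix \<beta>)))"
    if b: "\<beta> \<in> g1idx n" for \<beta>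
  proof -
    obtain j k b where \<beta>: "\<beta> = (j, k, b)" by (cases \<beta>)
    then have jk: "j < n - 2" "n - 2 \<le> k" "k < n" using b n by (auto simp: g1idx_def)
    have 1: "e1 n \<beta> = Mb n (fst (ix \<beta>)) (snd (ix \<beta>))" "e1neg n \<beta> = Mb n (snd (ix \<beta>)) (fst (ix \<beta>))"
      using jk by (auto simp: \<beta> ix_def rv_Mb)
    have "kappa n (e1neg n \<beta>) (e1 n \<beta>) = of_nat (2*n-2) * 2"
      unfolding 1 using jk by (intro kappa_Mb) (auto simp: \<beta> ix_def cj_def)
    then show ?thesis using 1 by (simp add: e1dual_def)
  qed
  have "omega2 n Y v = (\<Sum>x\<in>{..<n-2} \<times> Qs n. \<Sum>y\<in>{..<n-2} \<times> Qs n.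
     polarB n Y (Mb n (fst x) (snd x)) (Mb n (fst y) (snd y)) *
     wd [msc ?c (Mb n (snd x) (fst x)), msc ?c (Mb n (snd y) (fst y))] v)" for v
  proof -
    have "omega2 n Y v = (\<Sum>\<beta>\<in>g1idx n. \<Sum>\<beta>'\<in>g1idx n.
      polarB n Y (Mb n (fst (ix \<beta>)) (snd (ix \<beta>))) (Mb n (fst (ix \<beta>')) (snd (ix \<beta>'))) *
       wd [msc ?c (Mb n (snd (ix \<beta>)) (fst (ix \<beta>))), msc ?c (Mb n (snd (ix \<beta>')) (fst (ix \<beta>')))] v)"
      unfolding omega2_def by (intro sum.cong refl) (use e in \<open>simp only:\<close>)
    also have "\<dots> = (\<Sum>\<beta>\<in>g1idx n. \<Sum>y\<in>{..<n-2} \<times> Qs n.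
      polarB n Y (Mb n (fst (ix \<beta>)) (snd (ix \<beta>))) (Mb n (fst y) (snd y)) *
       wd [msc ?c (Mb n (snd (ix \<beta>)) (fst (ix \<beta>))), msc ?c (Mb n (snd y) (fst y))] v)"
      by (intro sum.cong refl sum.reindex_bij_betw[OF bij])
    also have "\<dots> = (\<Sum>x\<in>{..<n-2} \<times> Qs n. \<Sum>y\<in>{..<n-2} \<times> Qs n.
      polarB n Y (Mb n (fst x) (snd x)) (Mb n (fst y) (snd y)) *
       wd [msc ?c (Mb n (snd x) (fst x)), msc ?c (Mb n (snd y) (fst y))] v)"
      by (rule sum.reindex_bij_betw[OF bij])
    finally show ?thesis .
  qed
  then show ?thesis by (intro ext) (simp only: sum.cartesian_product' fst_conv snd_conv)
qed

section \<open>The action of the nilradical\<close>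

text \<open>Letters are formal: \<open>lmul X f\<close> is linear in \<open>X\<close> only modulo
  \<open>Kid\<close>, and the relations apply to words with letters in \<open>so n\<close>. This
  predicate records a form of \<open>f\<close> for which that linearity is available. The index type
  is fixed to the one that \<open>omega2\<close> uses, since a type cannot be quantified
  existentially.\<close>

definition word_sum :: "nat \<Rightarrow> fvec \<Rightarrow> bool" where
  "word_sum n f \<longleftrightarrow> (\<exists>(T :: (nat \<times> nat \<times> nat \<times> nat) set) b w.
     f = (\<lambda>v. \<Sum>t\<in>T. b t * wd (w t) v) \<and> (\<forall>t\<in>T. set (w t) \<subseteq> so n))"

lemma omega2_words:
  assumes "2 \<le> n"
  shows "omega2 n Y = (\<lambda>v. \<Sum>(i, p, j, q)\<in>{..<n-2} \<times> Qs n \<times> {..<n-2} \<times> Qs n.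
     polarB n Y (Mb n i p) (Mb n j q) *
     wd [msc (1 / (of_nat (2*n-2) * 2)) (Mb n p i), msc (1 / (of_nat (2*n-2) * 2)) (Mb n q j)] v)"
  unfolding omega2_Mb[OF assms] by (simp only: sum.cartesian_product' split_conv)

lemma word_sum_omega2:
  assumes n: "2 \<le> n"
  shows "word_sum n (omega2 n Y)"
  unfolding word_sum_def
proof (intro exI conjI)
  let ?c = "1 / (of_nat (2*n-2) * 2) :: complex"
  show "omega2 n Y = (\<lambda>v. \<Sum>t\<in>{..<n-2} \<times> Qs n \<times> {..<n-2} \<times> Qs n.
     (\<lambda>(i, p, j, q). polarB n Y (Mb n i p) (Mb n j q)) t *
     wd ((\<lambda>(i, p, j, q). [msc ?c (Mb n p i), msc ?c (Mb n q j)]) t) v)"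
    unfolding omega2_words[OF n] by (intro ext sum.cong refl) (simp only: split_beta)
  show "\<forall>t\<in>{..<n-2} \<times> Qs n \<times> {..<n-2} \<times> Qs n. set ((\<lambda>(i, p, j, q). [msc ?c (Mb n p i), msc ?c (Mb n q j)]) t) \<subseteq> so n"
    using Qs_less[OF n] by (auto intro!: so_msc Mb_so)
qed

lemma keq_lmul_sum:
  assumes "word_sum n f" "finite S" "\<And>k. k \<in> S \<Longrightarrow> x k \<in> so n"
  shows "keq n s (lmul (\<lambda>a b. \<Sum>k\<in>S. c k * x k a b) f) (\<lambda>v. \<Sum>k\<in>S. c k * lmul (x k) f v)"
proof -
  from assms(1) obtain T :: "(nat \<times> nat \<times> nat \<times> nat) set" and b w where
    f: "f = (\<lambda>v. \<Sum>t\<in>T. b t * wd (w t) v)" and w: "\<And>t. t \<in> T \<Longrightarrow> set (w t) \<subseteq> so n"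
    unfolding word_sum_def by blast
  have l: "lmul X f = (\<lambda>v. \<Sum>t\<in>T. b t * wd (X # w t) v)" for X
    unfolding f lmul_sum lmul_scale lmul_wd ..
  have "(\<Sum>k\<in>S. c k * lmul (x k) f v) = (\<Sum>t\<in>T. b t * (\<Sum>k\<in>S. c k * wd (x k # w t) v))" for v
  proof -
    have "(\<Sum>k\<in>S. c k * lmul (x k) f v) = (\<Sum>k\<in>S. \<Sum>t\<in>T. b t * (c k * wd (x k # w t) v))"
      unfolding l by (simp add: sum_distrib_left mult.left_commute)
    also have "\<dots> = (\<Sum>t\<in>T. \<Sum>k\<in>S. b t * (c k * wd (x k # w t) v))" by (rule sum.swap)
    finally show ?thesis by (simp only: sum_distrib_left)
  qed
  moreover have "keq n s (\<lambda>v. \<Sum>t\<in>T. b t * wd ((\<lambda>a b. \<Sum>k\<in>S. c k * x k a b) # w t) v)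
     (\<lambda>v. \<Sum>t\<in>T. b t * (\<Sum>k\<in>S. c k * wd (x k # w t) v))"
    using keq_letter_sum[of "[]" n, OF _ w assms(2,3)] by (intro keq_sum keq_scale) simp
  ultimately show ?thesis unfolding l by simp
qed

lemma keq_lmul_brk:
  assumes "word_sum n f" "x \<in> so n" "y \<in> so n"
  shows "keq n s (lmul (brk n x y) f) (\<lambda>v. lmul x (lmul y f) v - lmul y (lmul x f) v)"
proof -
  from assms(1) obtain T :: "(nat \<times> nat \<times> nat \<times> nat) set" and b w where
    f: "f = (\<lambda>v. \<Sum>t\<in>T. b t * wd (w t) v)" and w: "\<And>t. t \<in> T \<Longrightarrow> set (w t) \<subseteq> so n"
    unfolding word_sum_def by blast
  have k: "keq n s (wd (brk n x y # w t)) (\<lambda>v. wd (x # y # w t) v - wd (y # x # w t) v)" if "t \<in> T" for t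
    using Kid.scl[OF Kid.comm[of "[]" n "w t" x y s], of "-1"] w[OF that] assms(2,3)
    by (simp add: keq_def algebra_simps)
  have "keq n s (\<lambda>v. \<Sum>t\<in>T. b t * wd (brk n x y # w t) v)
    (\<lambda>v. \<Sum>t\<in>T. b t * (wd (x # y # w t) v - wd (y # x # w t) v))"
    by (intro keq_sum keq_scale k)
  then show ?thesis
    unfolding f lmul_sum lmul_scale lmul_wd by (simp only: right_diff_distrib sum_subtractf)
qed

lemma keq_letter3:
  assumes "a \<in> so n" "b \<in> so n" "d \<in> so n"
  shows "keq n s (wd [\<lambda>x y. \<alpha> * a x y + \<beta> * b x y + d x y]) (\<lambda>v. \<alpha> * wd [a] v + \<beta> * wd [b] v + wd [d] v)"
proof -
  have so: "msc \<alpha> a \<in> so n" "msc \<beta> b \<in> so n" "(\<lambda>x y. msc \<alpha> a x y + msc \<beta> b x y) \<in> so n"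
    using assms by (auto intro: so_msc so_add)
  have 1: "(\<lambda>v. wd [\<lambda>x y. msc \<alpha> a x y + msc \<beta> b x y + d x y] v - wd [\<lambda>x y. msc \<alpha> a x y + msc \<beta> b x y] v - wd [d] v) \<in> Kid n s"
    using Kid.lin_add[of "[]" n "[]", OF _ _ so(3) assms(3), of s] by simp
  have 2: "(\<lambda>v. wd [\<lambda>x y. msc \<alpha> a x y + msc \<beta> b x y] v - wd [msc \<alpha> a] v - wd [msc \<beta> b] v) \<in> Kid n s"
    using Kid.lin_add[of "[]" n "[]", OF _ _ so(1,2), of s] by simp
  have 3: "(\<lambda>v. wd [msc c e] v - c * wd [e] v) \<in> Kid n s" if "e \<in> so n" for c e
    using Kid.lin_scl[of "[]" n "[]", OF _ _ that, of c s] by simp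
  show ?thesis
    unfolding keq_def
    using Kid.add[OF Kid.add[OF 1 2] Kid.add[OF 3[OF assms(1), of \<alpha>] 3[OF assms(2), of \<beta>]]]
    by (simp add: algebra_simps msc_def)
qed

text \<open>Each summand reduces to single letters from g(-1). Linearity of letters, read from right
  to left, collects all of them in one matrix, to which \<open>contraction_sum\<close> applies entry
  by entry. The square comes from the normalization of the two dual root vectors.\<close>

lemma lmul_omega2:
  assumes n: "2 \<le> n" and Y: "Y \<in> LZbar n" and k: "k < n - 2" and r: "r \<in> Qs n"
  shows "keq n s (lmul (Mb n k r) (omega2 n Y)) (wd [\<lambda>x y. 2 * (1 - s) * (1 / (of_nat (2*n-2) * 2))\<^sup>2 *
     (\<Sum>j<n-2. \<Sum>q\<in>Qs n. polarB n Y (Mb n k r) (Mb n j q) * Mb n q j x y)])"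
proof -
  define c where "c = 1 / (of_nat (2*n-2) * 2 :: complex)"
  define X where "X = Mb n k r"
  define B where "B i p j q = polarB n Y (Mb n i p) (Mb n j q)" for i p j q
  define e where "e p i = msc c (Mb n p i)" for p i
  define W where "W i p j q = (\<lambda>x y. chi n s (brk n X (e q j)) * e p i x y + chi n s (brk n X (e p i)) * e q j x y
      + brk n (brk n X (e p i)) (e q j) x y)" for i p j q
  let ?S = "{..<n-2} \<times> Qs n \<times> {..<n-2} \<times> Qs n"
  have Xlt: "k < 2*n" "r < 2*n" using k Qs_less[OF n r] by auto
  have Xso: "X \<in> so n" unfolding X_def by (rule Mb_so[OF Xlt])
  have Xq: "X \<in> qpar n"
    unfolding X_def using hq_low[OF k] hq_Qs[OF n r] by (intro Mb_qpar Xlt n) simp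
  have Xchi: "chi n s X = 0"
  proof -
    have "Mb n k r l l = 0" if "l < n - 2" for l
      using Qs_neq[OF n r that] Qs_neq[OF n Qs_cj[OF n r] that] by (auto simp: Mb_def Emat_def)
    then show ?thesis by (simp add: chi_def X_def)
  qed
  have eso: "e p i \<in> so n" if "p \<in> Qs n" "i < n - 2" for p i
    unfolding e_def using Qs_less[OF n that(1)] that(2) by (intro so_msc Mb_so) auto
  have Wso: "W i p j q \<in> so n" if "i < n-2" "p \<in> Qs n" "j < n-2" "q \<in> Qs n" for i p j q
  proof -
    have "(\<lambda>x y. msc (chi n s (brk n X (e q j))) (e p i) x y + msc (chi n s (brk n X (e p i))) (e q j) x y
      + brk n (brk n X (e p i)) (e q j) x y) \<in> so n"
      using that by (intro so_add so_msc so_brk eso Xso)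
    then show ?thesis by (simp add: W_def msc_def)
  qed
  have 1: "lmul X (omega2 n Y) = (\<lambda>v. \<Sum>t\<in>?S. (\<lambda>(i, p, j, q). B i p j q) t * wd ((\<lambda>(i, p, j, q). [X, e p i, e q j]) t) v)"
    unfolding omega2_words[OF n] lmul_sum split_beta lmul_scale lmul_wd B_def e_def c_def X_def ..
  have 2: "keq n s (\<lambda>v. \<Sum>t\<in>?S. (\<lambda>(i, p, j, q). B i p j q) t * wd ((\<lambda>(i, p, j, q). [X, e p i, e q j]) t) v)
     (\<lambda>v. \<Sum>t\<in>?S. (\<lambda>(i, p, j, q). B i p j q) t * wd [(\<lambda>(i, p, j, q). W i p j q) t] v)"
  proof (intro keq_sum keq_scale)
    fix t assume "t \<in> ?S"
    then obtain i p j q where t: "t = (i, p, j, q)" and m: "i < n-2" "p \<in> Qs n" "j < n-2" "q \<in> Qs n" by auto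
    have qp: "brk n X (e p i) \<in> qpar n" "brk n X (e q j) \<in> qpar n"
      unfolding X_def e_def using m by (auto intro!: brk_Mb_qpar n k r)
    have "keq n s (wd [X, e p i, e q j]) (wd [W i p j q])"
      unfolding W_def
      using keq_trans[OF keq_three_letters[OF Xso eso[OF m(2,1)] eso[OF m(4,3)] Xq qp Xchi]
         keq_sym[OF keq_letter3[OF eso[OF m(2,1)] eso[OF m(4,3)] so_brk[OF so_brk[OF Xso eso[OF m(2,1)]] eso[OF m(4,3)]]]]] .
    then show "keq n s (wd ((\<lambda>(i, p, j, q). [X, e p i, e q j]) t)) (wd [(\<lambda>(i, p, j, q). W i p j q) t])"
      by (simp only: t split_conv)
  qed
  have 3: "keq n s (\<lambda>v. \<Sum>t\<in>?S. (\<lambda>(i, p, j, q). B i p j q) t * wd [(\<lambda>(i, p, j, q). W i p j q) t] v)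
     (wd [\<lambda>x y. \<Sum>t\<in>?S. (\<lambda>(i, p, j, q). B i p j q) t * (\<lambda>(i, p, j, q). W i p j q) t x y])"
  proof (rule keq_sym)
    have "(\<lambda>(i, p, j, q). W i p j q) t \<in> so n" if "t \<in> ?S" for t
      using that Wso by (cases t) auto
    moreover have "finite ?S" using finite_Qs by simp
    ultimately show "keq n s (wd [\<lambda>x y. \<Sum>t\<in>?S. (\<lambda>(i, p, j, q). B i p j q) t * (\<lambda>(i, p, j, q). W i p j q) t x y])
      (\<lambda>v. \<Sum>t\<in>?S. (\<lambda>(i, p, j, q). B i p j q) t * wd [(\<lambda>(i, p, j, q). W i p j q) t] v)"
      using keq_letter_sum[of "[]" n "[]" ?S "\<lambda>(i, p, j, q). W i p j q" s "\<lambda>(i, p, j, q). B i p j q"] by simp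
  qed
  have 4: "(\<Sum>t\<in>?S. (\<lambda>(i, p, j, q). B i p j q) t * (\<lambda>(i, p, j, q). W i p j q) t x y) =
      2 * (1 - s) * c\<^sup>2 * (\<Sum>j<n-2. \<Sum>q\<in>Qs n. B k r j q * Mb n q j x y)" for x y
  proof -
    obtain S K where spl: "splits n B S K" using polarB_splits[OF n Y] unfolding B_def by blast
    have Weq: "W i p j q x y = c\<^sup>2 * (- s * of_bool (j = k) * of_bool (q = r) * Mb n p i x y - s * of_bool (i = k) * of_bool (p = r) * Mb n q j x y
       - of_bool (j = k) * of_bool (p = r) * Mb n q i x y
       - of_bool (i = k) * of_bool (q = r) * Mb n p j x y
       + of_bool (i = k) * of_bool (q = cj n p) * Mb n (cj n r) j x y)"
      if m: "i < n-2" "p \<in> Qs n" "j < n-2" "q \<in> Qs n" for i p j q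
      unfolding W_def e_def X_def brk_msc_right brk_msc_left chi_msc
        chi_brk_Mb[OF n k m(1) r m(2)] chi_brk_Mb[OF n k m(3) r m(4)]
      unfolding msc_def brk_brk_Mb_grade[OF n k m(1,3) r m(2,4)]
      by (simp add: algebra_simps power2_eq_square)
    have "(\<Sum>t\<in>?S. (\<lambda>(i, p, j, q). B i p j q) t * (\<lambda>(i, p, j, q). W i p j q) t x y)
      = (\<Sum>i<n-2. \<Sum>p\<in>Qs n. \<Sum>j<n-2. \<Sum>q\<in>Qs n. B i p j q * W i p j q x y)"
      by (simp only: sum.cartesian_product' split_conv)
    also have "\<dots> = (\<Sum>i<n-2. \<Sum>p\<in>Qs n. \<Sum>j<n-2. \<Sum>q\<in>Qs n. c\<^sup>2 * (B i p j q *
       (- s * of_bool (j = k) * of_bool (q = r) * Mb n p i x y - s * of_bool (i = k) * of_bool (p = r) * Mb n q j x y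
       - of_bool (j = k) * of_bool (p = r) * Mb n q i x y
       - of_bool (i = k) * of_bool (q = r) * Mb n p j x y
       + of_bool (i = k) * of_bool (q = cj n p) * Mb n (cj n r) j x y)))"
      by (intro sum.cong refl) (simp only: Weq lessThan_iff mult.left_commute)
    also have "\<dots> = c\<^sup>2 * (2 * (1 - s) * (\<Sum>j<n-2. \<Sum>q\<in>Qs n. B k r j q * Mb n q j x y))"
      unfolding sum_distrib_left[symmetric] contraction_sum[OF n spl k r, of s "\<lambda>p i. Mb n p i x y"] ..
    finally show ?thesis by (simp only: mult_ac)
  qed
  show ?thesis
    unfolding B_def[symmetric] c_def[symmetric]
    unfolding X_def[symmetric] 1 using keq_trans[OF 2 3] unfolding 4 .
qed

section \<open>From g(1) to the whole nilradical\<close>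

lemma Mb_nrad:
  assumes "a < 2*n" "b < 2*n" "2 \<le> n" "hq n b < hq n a"
  shows "Mb n a b \<in> nrad n"
  unfolding nrad_def using assms by (intro Mb_gpart) auto

lemma lmul_g1_omega2_Kid:
  assumes n: "2 \<le> n" and Y: "Y \<in> LZbar n" and k: "k < n - 2" and r: "r \<in> Qs n"
  shows "lmul (Mb n k r) (omega2 n Y) \<in> Kid n 1"
proof -
  have "keq n 1 (lmul (Mb n k r) (omega2 n Y)) (wd [\<lambda>x y. 0])"
    using lmul_omega2[OF n Y k r, of 1] by simp
  moreover have "keq n 1 (wd [\<lambda>x y. 0]) (\<lambda>v. 0)"
    using keq_letter_zero[of "[]" n "[]" 1] by simp
  ultimately show ?thesis using keq_Kid Kid.zero by blast
qed

lemma lmul_Mb_omega2_Kid: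
  assumes n: "2 \<le> n" and Y: "Y \<in> LZbar n" and ab: "a < 2*n" "b < 2*n" and h: "hq n b < hq n a"
  shows "lmul (Mb n a b) (omega2 n Y) \<in> Kid n 1"
proof -
  note ws = word_sum_omega2[OF n, of Y]
  \<comment> \<open>The cases are g(1) in its standard indices, g(1) in conjugated indices, and
    g(2).\<close>
  consider (1) "a < n - 2" "b \<in> Qs n" | (2) "a \<in> Qs n" "cj n b < n - 2" | (3) "a < n - 2" "cj n b < n - 2" "n \<le> b"
    using h ab n by (auto simp: hq_def Qs_iff cj_def split: if_splits)
  then show ?thesis
  proof cases
    case 1
    then show ?thesis using lmul_g1_omega2_Kid[OF n Y] by blast
  next
    case 2
    let ?x = "Mb n (cj n b) (cj n a)"
    have "?x \<in> so n" using ab by (intro Mb_so cj_less)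
    then have "keq n 1 (lmul (\<lambda>x y. \<Sum>k\<in>{()}. (-1) * ?x x y) (omega2 n Y))
        (\<lambda>v. \<Sum>k\<in>{()}. (-1) * lmul ?x (omega2 n Y) v)"
      by (intro keq_lmul_sum[OF ws]) auto
    moreover have "(\<lambda>x y. \<Sum>k\<in>{()}. (-1) * ?x x y) = Mb n a b"
      using Mb_cj[OF ab] by (intro ext) simp
    moreover have "(\<lambda>v. (-1) * lmul ?x (omega2 n Y) v) \<in> Kid n 1"
      by (intro Kid.scl lmul_g1_omega2_Kid[OF n Y] 2 Qs_cj[OF n])
    ultimately show ?thesis using keq_Kid by simp
  next
    case 3
    \<comment> \<open>A root of g(2) is written as a sum of two roots of g(1) by inserting a
      conjugate pair of indices of \<open>V\<close>. In the bracket only the term for matching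
      conjugate indices survives.\<close>
    let ?x = "Mb n (cj n b) (n + (n - 2))" and ?y = "Mb n a (n - 2)"
    have q: "n + (n - 2) \<in> Qs n" "n - 2 \<in> Qs n" by (auto simp: Qs_def)
    have so: "?x \<in> so n" "?y \<in> so n" using 3 n by (auto intro!: Mb_so)
    have b: "cj n (cj n b) = b" using ab by (simp add: cj_cj)
    have "brk n ?x ?y = (\<lambda>x y. - Mb n (cj n b) (cj n a) x y)"
    proof -
      have "n + (n - 2) \<noteq> a" "n - 2 \<noteq> cj n b" "n + (n - 2) = cj n (n - 2)" "cj n a \<noteq> cj n b"
        using 3 n by (auto simp: cj_def)
      moreover have "cj n b < 2*n" "n + (n - 2) < 2*n" "a < 2*n" "n - 2 < 2*n"
        using 3 n by auto
      ultimately show ?thesis by (subst brk_Mb) auto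
    qed
    then have br: "brk n ?x ?y = Mb n a b" using Mb_cj[OF ab] by (intro ext) simp
    have "(\<lambda>v. lmul ?x (lmul ?y (omega2 n Y)) v - lmul ?y (lmul ?x (omega2 n Y)) v) \<in> Kid n 1"
      using Kid.add[OF Kid_lmul[OF lmul_g1_omega2_Kid[OF n Y 3(1) q(2)] so(1)]
          Kid.scl[OF Kid_lmul[OF lmul_g1_omega2_Kid[OF n Y 3(2) q(1)] so(2)], of "-1"]]
      by simp
    then show ?thesis using keq_Kid[OF keq_lmul_brk[OF ws so, of 1]] br by simp
  qed
qed

text \<open>The halves are due to double counting: at conjugated positions both the entry of
  \<open>X\<close> and the vector \<open>Mb\<close> change sign, so the two products agree.\<close>

lemma so_decomp:
  assumes "X \<in> so n"
  shows "(\<lambda>x y. \<Sum>t\<in>{..<2*n} \<times> {..<2*n}. (X (fst t) (snd t) / 2) * Mb n (fst t) (snd t) x y) = X"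
proof (intro ext)
  fix x y
  have "(\<Sum>t\<in>{..<2*n} \<times> {..<2*n}. (X (fst t) (snd t) / 2) * Mb n (fst t) (snd t) x y)
    = (\<Sum>t\<in>{..<2*n} \<times> {..<2*n}. (if t = (x, y) then X (fst t) (snd t) / 2 else 0)
       - (if t = (cj n y, cj n x) then (if x < 2*n \<and> y < 2*n then X (fst t) (snd t) / 2 else 0) else 0))"
  proof (intro sum.cong refl)
    fix t assume t: "t \<in> {..<2*n} \<times> {..<2*n}"
    then have lt: "fst t < 2*n" "snd t < 2*n" by auto
    have 1: "(x = fst t \<and> y = snd t) = (t = (x, y))" by (cases t) auto
    have 2: "(x = cj n (snd t) \<and> y = cj n (fst t)) = (t = (cj n y, cj n x) \<and> x < 2*n \<and> y < 2*n)"
      using lt by (cases t) (auto simp: cj_cj cj_less)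
    have 3: "a * ((if P then 1 else 0) - (if Q \<and> R then 1 else 0))
        = (if P then a else 0) - (if Q then (if R then a else 0) else 0)" for a :: complex and P Q R
      by simp
    show "(X (fst t) (snd t) / 2) * Mb n (fst t) (snd t) x y = (if t = (x, y) then X (fst t) (snd t) / 2 else 0)
       - (if t = (cj n y, cj n x) then (if x < 2*n \<and> y < 2*n then X (fst t) (snd t) / 2 else 0) else 0)"
      unfolding Mb_def Emat_def 1 2 by (rule 3)
  qed
  also have "\<dots> = (if x < 2*n \<and> y < 2*n then X x y / 2 - X (cj n y) (cj n x) / 2 else 0)"
    by (auto simp: sum_subtractf cj_less)
  also have "\<dots> = X x y" using so_cj[OF assms, of y x] so_zero[OF assms, of x y] by auto
  finally show "(\<Sum>t\<in>{..<2*n} \<times> {..<2*n}. (X (fst t) (snd t) / 2) * Mb n (fst t) (snd t) x y) = X x y" .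
qed

lemma Kid_sum: "(\<And>k. k \<in> S \<Longrightarrow> f k \<in> Kid n s) \<Longrightarrow> (\<lambda>v. \<Sum>k\<in>S. f k v) \<in> Kid n s"
  by (induction S rule: infinite_finite_induct) (auto intro: Kid.zero Kid.add)

lemma lmul_nrad_omega2_Kid:
  assumes n: "2 \<le> n" and Y: "Y \<in> LZbar n" and X: "X \<in> nrad n"
  shows "lmul X (omega2 n Y) \<in> Kid n 1"
proof -
  let ?T = "{..<2*n} \<times> {..<2*n}"
  have Xso: "X \<in> so n" using X unfolding nrad_def gpart_def by simp
  have "keq n 1 (lmul X (omega2 n Y)) (\<lambda>v. \<Sum>t\<in>?T. (X (fst t) (snd t) / 2) * lmul (Mb n (fst t) (snd t)) (omega2 n Y) v)"
    using keq_lmul_sum[OF word_sum_omega2[OF n, of Y], of ?T "\<lambda>t. Mb n (fst t) (snd t)" 1 "\<lambda>t. X (fst t) (snd t) / 2"]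
    unfolding so_decomp[OF Xso] by (simp add: Mb_so mem_Times_iff)
  moreover have "(\<lambda>v. \<Sum>t\<in>?T. (X (fst t) (snd t) / 2) * lmul (Mb n (fst t) (snd t)) (omega2 n Y) v) \<in> Kid n 1"
  proof (rule Kid_sum)
    fix t assume t: "t \<in> ?T"
    show "(\<lambda>v. (X (fst t) (snd t) / 2) * lmul (Mb n (fst t) (snd t)) (omega2 n Y) v) \<in> Kid n 1"
    proof (cases "X (fst t) (snd t) = 0")
      case True
      then show ?thesis by (simp add: Kid.zero)
    next
      case False
      then have "hq n (fst t) - hq n (snd t) > 0" using X unfolding nrad_def gpart_def by blast
      then show ?thesis using t by (intro Kid.scl lmul_Mb_omega2_Kid[OF n Y]) auto
    qed
  qed
  ultimately show ?thesis using keq_Kid by blast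
qed

section \<open>The Levi action on tensors, and invariance at s = 1\<close>

lemma act4_kron:
  "act4 n Z (kron C D) = (\<lambda>a b c d. kron (brk n Z C) D a b c d + kron C (brk n Z D) a b c d)"
  unfolding act4_def kron_def brk_def mmul_def
  by (intro ext) (simp add: sum_distrib_left sum_distrib_right algebra_simps)

lemma act4_add:
  "act4 n Z (\<lambda>a b c d. T a b c d + U a b c d) = (\<lambda>a b c d. act4 n Z T a b c d + act4 n Z U a b c d)"
  unfolding act4_def by (intro ext) (simp add: sum.distrib algebra_simps)

lemma act4_scale: "act4 n Z (\<lambda>a b c d. k * T a b c d) = (\<lambda>a b c d. k * act4 n Z T a b c d)"
  unfolding act4_def by (intro ext) (simp add: sum_distrib_left algebra_simps)

lemma act4_zero: "act4 n Z (\<lambda>a b c d. 0) = (\<lambda>a b c d. 0)"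
  unfolding act4_def by simp

lemma act4_sum:
  "act4 n Z (\<lambda>a b c d. \<Sum>k\<in>S. T k a b c d) = (\<lambda>a b c d. \<Sum>k\<in>S. act4 n Z (T k) a b c d)"
  by (induction S rule: infinite_finite_induct) (simp_all add: act4_zero act4_add)

lemma LZbar_act:
  assumes Z: "Z \<in> lev n" and "T \<in> LZbar n"
  shows "act4 n Z T \<in> LZbar n"
  using assms(2)
proof induction
  case (gen C D)
  have "brk n Z C \<in> lev n" using Z gen(1) unfolding lev_def by (rule gpart_brk) auto
  moreover have "brk n Z D \<in> zbar n" using Z gen(2) unfolding lev_def zbar_def by (rule gpart_brk) auto
  ultimately show ?case unfolding act4_kron using gen by (intro LZbar.add LZbar.gen)
next
  case zero
  then show ?case by (simp add: act4_zero LZbar.zero)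
next
  case (add T T')
  then show ?case by (simp add: act4_add LZbar.add)
next
  case (scl T k)
  then show ?case by (simp add: act4_scale LZbar.scl)
qed

lemma Wdual_LZbar: "T \<in> Wdual n \<nu> \<Longrightarrow> T \<in> LZbar n"
  by (induction rule: Wdual.induct) (auto simp: lowest_vec_def intro: LZbar.zero LZbar.add LZbar.scl LZbar_act)

lemma conf_inv_one: "2 \<le> n \<Longrightarrow> conf_inv n \<nu> 1"
  unfolding conf_inv_def using lmul_nrad_omega2_Kid Wdual_LZbar by blast

text \<open>If \<open>s\<close> differs from 1, \<open>lmul_omega2\<close> makes a single letter of
  g(-1) vanish in the module, while a nonzero value of the form makes that letter nonzero;
  \<open>letter_notin_Kid\<close> excludes this.\<close>

lemma conf_inv_unique:
  assumes n: "2 \<le> n" and inv: "conf_inv n \<nu> s" and Y: "Y \<in> Wdual n \<nu>"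
    and k: "k < n - 2" and r: "r \<in> Qs n" and j: "j < n - 2" and q: "q \<in> Qs n"
    and nz: "polarB n Y (Mb n k r) (Mb n j q) \<noteq> 0"
  shows "s = 1"
proof (rule ccontr)
  assume s: "s \<noteq> 1"
  let ?F = "\<lambda>x y. 2 * (1 - s) * (1 / (of_nat (2*n-2) * 2))\<^sup>2 *
     (\<Sum>j<n-2. \<Sum>q\<in>Qs n. polarB n Y (Mb n k r) (Mb n j q) * Mb n q j x y)"
  have "Mb n k r \<in> nrad n"
    using k Qs_less[OF n r] n hq_low[OF k] hq_Qs[OF n r] by (intro Mb_nrad) auto
  then have "lmul (Mb n k r) (omega2 n Y) \<in> Kid n s" using inv Y unfolding conf_inv_def by blast
  then have K: "wd [?F] \<in> Kid n s"
    using keq_Kid[OF lmul_omega2[OF n Wdual_LZbar[OF Y] k r, of s]] by blast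
  have "(\<Sum>j'<n-2. \<Sum>q'\<in>Qs n. polarB n Y (Mb n k r) (Mb n j' q') * Mb n q' j' q j)
     = (\<Sum>j'<n-2. \<Sum>q'\<in>Qs n. polarB n Y (Mb n k r) (Mb n j' q') * of_bool (j' = j) * of_bool (q' = q))"
  proof (intro sum.cong refl)
    fix j' q' assume "j' \<in> {..<n-2}" and q': "q' \<in> Qs n"
    then have j': "j' < n - 2" by simp
    \<comment> \<open>The second nonzero entry of \<open>Mb n q' j'\<close> sits in row
      \<open>cj n j'\<close>, outside \<open>V\<close>, so position \<open>(q, j)\<close> picks out
      exactly one coefficient.\<close>
    have "cj n j' \<noteq> q" using Qs_neq[OF n q j'] j' by (auto simp: cj_def)
    then have "Mb n q' j' q j = of_bool (j' = j) * of_bool (q' = q)" by (auto simp: Mb_def Emat_def)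
    then show "polarB n Y (Mb n k r) (Mb n j' q') * Mb n q' j' q j =
      polarB n Y (Mb n k r) (Mb n j' q') * of_bool (j' = j) * of_bool (q' = q)" by (simp only: mult.assoc)
  qed
  also have "\<dots> = polarB n Y (Mb n k r) (Mb n j q)"
    using j by (simp only: sum_mult_of_bool[OF finite_Qs q] sum_mult_of_bool[OF finite_lessThan] lessThan_iff)
  finally have F: "?F q j \<noteq> 0" using nz s n by simp
  have "n - 2 \<le> q" using q n by (auto simp: Qs_iff)
  from letter_notin_Kid[of n q j ?F s, OF this j F] K show False by blast
qed

section \<open>Lowest weight vectors and root counts\<close>

lemma Mb_cj_self: "b < 2*n \<Longrightarrow> Mb n (cj n b) b x y = 0"
  by (simp add: Mb_def cj_cj)

lemma brk_cartan_Mb: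
  assumes H: "H \<in> cartan n" and ab: "a < 2*n" "b < 2*n"
  shows "brk n H (Mb n a b) = msc (H a a - H b b) (Mb n a b)"
proof (intro ext)
  fix x y
  have Hso: "H \<in> so n" and H0: "\<And>x y. x \<noteq> y \<Longrightarrow> H x y = 0" using H unfolding cartan_def by auto
  have d: "H x y = of_bool (x = y) * H y y" for x y using H0[of x y] by auto
  have e: "H x y = of_bool (y = x) * H x x" for x y using H0[of x y] by auto
  have 1: "H (cj n b) (cj n b) = - H b b" "H (cj n a) (cj n a) = - H a a"
    using so_cj[OF Hso] ab by auto
  have "brk n H (Mb n a b) x y = of_bool (x = a) * H a a * of_bool (y = b) - of_bool (x = cj n b) * H (cj n b) (cj n b) * of_bool (y = cj n a)
     - (of_bool (x = a) * (of_bool (y = b) * H b b) - of_bool (x = cj n b) * (of_bool (y = cj n a) * H (cj n a) (cj n a)))"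
    unfolding brk_def mmul_Mb_left[OF ab] mmul_Mb_right[OF ab]
    by (simp only: d[of x a] d[of x "cj n b"] e[of b y] e[of "cj n a" y])
  also have "\<dots> = msc (H a a - H b b) (Mb n a b) x y"
    unfolding 1 msc_def Mb_def Emat_of_bool by (simp only: algebra_simps) simp
  finally show "brk n H (Mb n a b) x y = msc (H a a - H b b) (Mb n a b) x y" .
qed

lemma kron_msc: "kron (msc c A) B a b d e = c * kron A B a b d e" "kron A (msc c B) a b d e = c * kron A B a b d e"
  by (simp_all add: kron_def msc_def)

lemma act4_cartan_kron:
  assumes "H \<in> cartan n" "a < 2*n" "b < 2*n" "c < 2*n" "d < 2*n"
  shows "act4 n H (kron (Mb n a b) (Mb n c d)) x y z w
    = (H a a - H b b + H c c - H d d) * kron (Mb n a b) (Mb n c d) x y z w"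
  unfolding act4_kron brk_cartan_Mb[OF assms(1,2,3)] brk_cartan_Mb[OF assms(1,4,5)] kron_msc
  by (simp only: algebra_simps)

text \<open>The semisimple part of the Levi factor is sl(n-2) + so(4). Besides the negative roots of
  gl(U) there remain only the two negative roots of so(4), one for each factor sl(2).\<close>

lemma neg_l_cases:
  assumes "E \<in> neg_l n" "5 \<le> n"
  obtains (A) i j where "j < i" "i < n - 2" "E = Mb n i j"
    | (B) "E = Mb n (n - 1) (n - 2)" | (C) "E = Mb n (n + (n - 1)) (n - 2)"
proof -
  have lev: "E \<in> lev n" using assms unfolding neg_l_def by simp
  have h: "hq n a = hq n b" if "E = Mb n a b" "a < 2*n" "b < 2*n" "a \<noteq> cj n b" for a b
  proof -
    have "E a b \<noteq> 0" using that by (auto simp: Mb_def Emat_def)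
    then have "hq n a - hq n b = 0" using lev unfolding lev_def gpart_def by blast
    then show ?thesis by simp
  qed
  consider (1) i j where "j < i" "i < n" "E = rv_minus n i j" | (2) i j where "i < j" "j < n" "E = rv_mm n i j"
    using assms(1) unfolding neg_l_def by blast
  then show ?thesis
  proof cases
    case 1
    then have E: "E = Mb n i j" by (simp add: rv_Mb)
    have "hq n i = hq n j" using 1 by (intro h[OF E]) (auto simp: cj_def)
    then have "i < n - 2 \<or> (i = n - 1 \<and> j = n - 2)" using 1 by (auto simp: hq_def split: if_splits)
    then show ?thesis using A B 1 E by blast
  next
    case 2
    then have E: "E = Mb n (n + j) i" by (simp add: rv_Mb)
    have "hq n (n + j) = hq n i" using 2 by (intro h[OF E]) (auto simp: cj_def)
    then have "j = n - 1 \<and> i = n - 2" using 2 by (auto simp: hq_def split: if_splits)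
    then show ?thesis using C E by blast
  qed
qed

lemma Mb_lev: "a < 2*n \<Longrightarrow> b < 2*n \<Longrightarrow> 2 \<le> n \<Longrightarrow> hq n a = hq n b \<Longrightarrow> Mb n a b \<in> lev n"
  unfolding lev_def by (intro Mb_gpart) auto

lemma Mb_zbar: "k < n - 2 \<Longrightarrow> l < n - 2 \<Longrightarrow> Mb n (n + k) l \<in> zbar n"
  unfolding zbar_def by (intro Mb_gpart) (auto simp: hq_def)

text \<open>The last hypothesis admits brackets whose fourth term in \<open>brk_Mb\<close> is
  present but of the form \<open>Mb n (cj n b) b\<close>, which is zero.\<close>

lemma brk_Mb_0I:
  assumes "a < 2*n" "b < 2*n" "c < 2*n" "d < 2*n"
    "b \<noteq> c" "d \<noteq> a" "b \<noteq> cj n d" "cj n c = a \<Longrightarrow> b = d"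
  shows "brk n (Mb n a b) (Mb n c d) = (\<lambda>x y. 0)"
  unfolding brk_Mb[OF assms(1-4)] using assms(5-8) Mb_cj_self[OF assms(4)] by (intro ext) auto

lemma kron_0: "kron (\<lambda>x y. 0) B = (\<lambda>a b c d. 0)" "kron B (\<lambda>x y. 0) = (\<lambda>a b c d. 0)"
  by (auto simp: kron_def)

text \<open>The first factor is the lowest root vector of one sl(2) in so(V), the choice of
  \<open>c\<close> deciding which one. The second has weight -eps_1 - eps_2, the lowest in g(-2).
  Each factor is killed separately by the lowering operators.\<close>

lemma lowest_kron:
  assumes n: "5 \<le> n" and c: "c = n - 1 \<or> c = n + (n - 1)"
    and ev: "\<And>H. H \<in> cartan n \<Longrightarrow> evalw n \<nu> H = H 0 0 + H 1 1 + H (n-2) (n-2) - H c c"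
  shows "lowest_vec n \<nu> (kron (Mb n c (n-2)) (Mb n (n+1) 0))"
  unfolding lowest_vec_def
proof (intro conjI ballI)
  have lt: "c < 2*n" "n - 2 < 2*n" "n + 1 < 2*n" "0 < 2*n" using c n by auto
  have "Mb n c (n-2) \<in> lev n" using c n by (intro Mb_lev) (auto simp: hq_def)
  moreover have "Mb n (n+1) 0 \<in> zbar n" using n by (intro Mb_zbar) auto
  ultimately show "kron (Mb n c (n-2)) (Mb n (n+1) 0) \<in> LZbar n" by (rule LZbar.gen)
  fix H assume H: "H \<in> cartan n"
  then have "H \<in> so n" unfolding cartan_def by simp
  from so_cj[OF this, of 1 1] have "H (n+1) (n+1) = - H 1 1" using n by (simp add: cj_def)
  then have "H c c - H (n-2) (n-2) + H (n+1) (n+1) - H 0 0 = - evalw n \<nu> H"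
    unfolding ev[OF H] by simp
  then show "act4 n H (kron (Mb n c (n-2)) (Mb n (n+1) 0)) =
     (\<lambda>x y z w. - evalw n \<nu> H * kron (Mb n c (n-2)) (Mb n (n+1) 0) x y z w)"
    using act4_cartan_kron[OF H lt] by (intro ext) simp
next
  fix E assume E: "E \<in> neg_l n"
  have lt: "c < 2*n" "n - 2 < 2*n" "n + 1 < 2*n" "0 < 2*n" using c n by auto
  have cjs: "cj n 0 = n" "cj n (Suc n) = 1" "cj n (n-2) = n + (n-2)"
    "cj n c = (if c = n - 1 then n + (n - 1) else n - 1)"
    using n c by (auto simp: cj_def)
  have "brk n E (Mb n c (n-2)) = (\<lambda>x y. 0) \<and> brk n E (Mb n (n+1) 0) = (\<lambda>x y. 0)"
    using E n
  proof (cases rule: neg_l_cases)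
    case (A i j)
    have 1: "brk n E (Mb n c (n-2)) = (\<lambda>x y. 0)"
      unfolding A(3) using A(1,2) n c by (intro brk_Mb_0I lt) (auto simp: cjs split: if_splits)
    have 2: "brk n E (Mb n (n+1) 0) = (\<lambda>x y. 0)"
      unfolding A(3) using A(1,2) n by (intro brk_Mb_0I lt) (auto simp: cjs split: if_splits)
    show ?thesis using 1 2 by blast
  next
    case B
    have 1: "brk n E (Mb n c (n-2)) = (\<lambda>x y. 0)"
      unfolding B using n c by (intro brk_Mb_0I lt) (auto simp: cjs split: if_splits)
    have 2: "brk n E (Mb n (n+1) 0) = (\<lambda>x y. 0)"
      unfolding B using n by (intro brk_Mb_0I lt) (auto simp: cjs split: if_splits)
    show ?thesis using 1 2 by blast
  next
    case C
    have 1: "brk n E (Mb n c (n-2)) = (\<lambda>x y. 0)"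
      unfolding C using n c by (intro brk_Mb_0I lt) (auto simp: cjs split: if_splits)
    have 2: "brk n E (Mb n (n+1) 0) = (\<lambda>x y. 0)"
      unfolding C using n by (intro brk_Mb_0I lt) (auto simp: cjs split: if_splits)
    show ?thesis using 1 2 by blast
  qed
  then show "act4 n E (kron (Mb n c (n-2)) (Mb n (n+1) 0)) = (\<lambda>a b c d. 0)"
    by (simp add: act4_kron kron_0)
qed

lemma LZbar_sum: "(\<And>k. k \<in> S \<Longrightarrow> T k \<in> LZbar n) \<Longrightarrow> (\<lambda>a b c d. \<Sum>k\<in>S. T k a b c d) \<in> LZbar n"
  by (induction S rule: infinite_finite_induct) (auto intro: LZbar.zero LZbar.add)

text \<open>With e_k a basis of \<open>U\<close> and f_k the dual basis, this is the invariant sum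
  of e_k (x) f_k decorated with two copies of f_0, the lowest weight vector of the dual of
  \<open>U\<close>. Invariance of the sum makes it a lowest weight vector of weight -2 eps_1,
  although its single terms are not.\<close>

lemma lowest_sum:
  assumes n: "5 \<le> n" and ev: "\<And>H. H \<in> cartan n \<Longrightarrow> evalw n \<nu> H = 2 * H 0 0"
  shows "lowest_vec n \<nu> (\<lambda>a b c d. \<Sum>k<n-2. kron (Mb n k 0) (Mb n (n+k) 0) a b c d)"
  unfolding lowest_vec_def
proof (intro conjI ballI)
  show "(\<lambda>a b c d. \<Sum>k<n-2. kron (Mb n k 0) (Mb n (n+k) 0) a b c d) \<in> LZbar n"
    using n by (intro LZbar_sum LZbar.gen Mb_lev Mb_zbar) (auto simp: hq_def)
  fix H assume H: "H \<in> cartan n"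
  then have Hso: "H \<in> so n" unfolding cartan_def by simp
  have "act4 n H (kron (Mb n k 0) (Mb n (n+k) 0)) x y z w
     = - evalw n \<nu> H * kron (Mb n k 0) (Mb n (n+k) 0) x y z w" if "k < n - 2" for k x y z w
  proof -
    have "cj n k = n + k" "k < 2*n" using that by (auto simp: cj_def)
    with so_cj[OF Hso, of k k] have "H (n+k) (n+k) = - H k k" by simp
    then have "H k k - H 0 0 + H (n+k) (n+k) - H 0 0 = - evalw n \<nu> H" unfolding ev[OF H] by simp
    then show ?thesis using act4_cartan_kron[OF H, of k 0 "n+k" 0 x y z w] that by simp
  qed
  then show "act4 n H (\<lambda>a b c d. \<Sum>k<n-2. kron (Mb n k 0) (Mb n (n+k) 0) a b c d) =
     (\<lambda>a b c d. - evalw n \<nu> H * (\<Sum>k<n-2. kron (Mb n k 0) (Mb n (n+k) 0) a b c d))"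
    unfolding act4_sum by (intro ext) (simp add: sum_distrib_left)
next
  fix E assume E: "E \<in> neg_l n"
  have cj0: "cj n 0 = n" using n by (simp add: cj_def)
  from E n show "act4 n E (\<lambda>a b c d. \<Sum>k<n-2. kron (Mb n k 0) (Mb n (n+k) 0) a b c d) = (\<lambda>a b c d. 0)"
  proof (cases rule: neg_l_cases)
    case (A i j)
    have "act4 n E (kron (Mb n k 0) (Mb n (n+k) 0)) a b c d =
       kron (Mb n i 0) (Mb n (n+k) 0) a b c d * of_bool (k = j)
       - kron (Mb n k 0) (Mb n (n+j) 0) a b c d * of_bool (k = i)" if k: "k < n - 2" for k a b c d
    proof -
      have lt: "i < 2*n" "j < 2*n" "k < 2*n" "n + k < 2*n" "0 < 2*n" using A k by auto
      have cjk: "cj n k = n + k" "cj n (n + k) = k" using k by (auto simp: cj_def)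
      have ne: "0 \<noteq> i" "j \<noteq> n" "n + k \<noteq> i" "j \<noteq> n + k" using A k by auto
      have s: "(j = k) = (k = j)" by auto
      have 1: "brk n E (Mb n k 0) = msc (of_bool (k = j)) (Mb n i 0)"
        unfolding A(3) brk_Mb[OF lt(1,2,3,5)] cj0 cjk s msc_def using ne by (intro ext) simp
      have m: "Mb n n j x y = - Mb n (n + j) 0 x y" for x y
        using Mb_cj[of "n + j" n 0 x y] A(1,2) cj0 by (simp add: cj_def)
      have 2: "brk n E (Mb n (n+k) 0) = msc (- of_bool (k = i)) (Mb n (n + j) 0)"
        unfolding A(3) brk_Mb[OF lt(1,2,4,5)] cj0 cjk msc_def m using ne by (intro ext) simp
      show ?thesis unfolding act4_kron 1 2 kron_msc by (simp only: mult_ac mult_minus_left mult_minus_right diff_conv_add_uminus)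
    qed
    \<comment> \<open>Only \<open>k = j\<close> and \<open>k = i\<close> contribute; both give
      \<open>kron (Mb n i 0) (Mb n (n+j) 0)\<close>, with opposite signs.\<close>
    then show ?thesis
      unfolding act4_sum using A by (intro ext) (simp add: sum_subtractf sum_mult_of_bool)
  next
    case B
    have "brk n E (Mb n k 0) = (\<lambda>x y. 0)" "brk n E (Mb n (n+k) 0) = (\<lambda>x y. 0)" if "k < n - 2" for k
      unfolding B using that n by (intro brk_Mb_0I; auto simp: cj_def split: if_splits)+
    then show ?thesis unfolding act4_sum act4_kron by (simp add: kron_0)
  next
    case C
    have "brk n E (Mb n k 0) = (\<lambda>x y. 0)" "brk n E (Mb n (n+k) 0) = (\<lambda>x y. 0)" if "k < n - 2" for k
      unfolding C using that n by (intro brk_Mb_0I; auto simp: cj_def split: if_splits)+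
    then show ?thesis unfolding act4_sum act4_kron by (simp add: kron_0)
  qed
qed

text \<open>The arguments are chosen to hit the nonzero entries of both factors. Their
  \<open>V\<close>-indices are not conjugate, so the symmetric part contributes nothing.\<close>

lemma polarB_lowest_kron:
  assumes n: "5 \<le> n" and c: "c = n - 1 \<or> c = n + (n - 1)"
  shows "polarB n (kron (Mb n c (n-2)) (Mb n (n+1) 0)) (Mb n 1 (n + (n-2))) (Mb n 0 c) \<noteq> 0"
proof -
  have n2: "2 \<le> n" using n by simp
  have so: "Mb n c (n-2) \<in> so n" using c n by (intro Mb_so) auto
  have z: "Mb n (n+1) 0 \<in> zbar n" using n by (intro Mb_zbar) auto
  have q: "n + (n-2) \<in> Qs n" "c \<in> Qs n" using c by (auto simp: Qs_def)
  have e: "cj n (n + (n-2)) = n - 2" using n by (simp add: cj_def)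
  have "Mb n c (n-2) c (n-2) = 1" "Mb n (n+1) 0 (n+1) 0 = 1" "c \<noteq> n - 2"
    using c n by (auto simp: Mb_def Emat_def cj_def)
  then show ?thesis
    using polarB_kron_Mb[OF n2 so z, of 1 0 "n + (n-2)" c] q n e by simp
qed

text \<open>Conjugate \<open>V\<close>-indices and equal \<open>U\<close>-indices select the
  symmetric part. The term \<open>k = 0\<close> drops out since \<open>Mb n n 0\<close> is zero, and
  the other \<open>n - 3\<close> terms each give \<open>2*n-2\<close>, so nothing cancels.\<close>

lemma polarB_lowest_sum:
  assumes n: "5 \<le> n"
  shows "polarB n (\<lambda>a b c d. \<Sum>k<n-2. kron (Mb n k 0) (Mb n (n+k) 0) a b c d)
    (Mb n 0 (n-2)) (Mb n 0 (n + (n-2))) \<noteq> 0"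
proof -
  have n2: "2 \<le> n" using n by simp
  have q: "n - 2 \<in> Qs n" "n + (n-2) \<in> Qs n" by (auto simp: Qs_def)
  have e: "cj n (n-2) = n + (n - 2)" using n by (simp add: cj_def)
  have "polarB n (kron (Mb n k 0) (Mb n (n+k) 0)) (Mb n 0 (n-2)) (Mb n 0 (n + (n-2)))
      = of_nat (2*n-2) * of_bool (k \<noteq> 0)" if k: "k < n - 2" for k
  proof -
    have so: "Mb n k 0 \<in> so n" using k by (intro Mb_so) auto
    have z: "Mb n (n+k) 0 \<in> zbar n" using k by (intro Mb_zbar) auto
    have D0: "Mb n (n+k) 0 n 0 = 0" using k by (auto simp: Mb_def Emat_def cj_def)
    have "mmul n (Mb n (n+k) 0) (Mb n k 0) n 0 = of_bool (n = n + k) * Mb n k 0 0 0 - Mb n k 0 k 0"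
      using k by (subst mmul_Mb_left) (auto simp: cj_def)
    also have "\<dots> = - of_bool (k \<noteq> 0)" using k by (auto simp: Mb_def Emat_def cj_def)
    finally have m: "mmul n (Mb n (n+k) 0) (Mb n k 0) n 0 = - of_bool (k \<noteq> 0)" .
    show ?thesis
      using polarB_kron_Mb[OF n2 so z, of 0 0 "n-2" "n + (n-2)"] q n e D0 m by simp
  qed
  then have "polarB n (\<lambda>a b c d. \<Sum>k<n-2. kron (Mb n k 0) (Mb n (n+k) 0) a b c d)
    (Mb n 0 (n-2)) (Mb n 0 (n + (n-2))) = (\<Sum>k<n-2. of_nat (2*n-2) * of_bool (k \<noteq> 0))"
    unfolding polarB_sum by simp
  also have "\<dots> = of_nat (2*n-2) * (\<Sum>k<Suc (n-3). of_bool (k \<noteq> 0))"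
    using n by (simp only: sum_distrib_left) (simp add: Suc_diff_le numeral_3_eq_3 numeral_2_eq_2 Suc_diff_Suc)
  also have "(\<Sum>k<Suc (n-3). of_bool (k \<noteq> 0)) = (of_nat (n-3) :: complex)"
    by (subst sum.lessThan_Suc_shift) simp
  finally show ?thesis using n by (simp only: mult_eq_0_iff of_nat_eq_0_iff) arith
qed

lemma sum_epsw:
  assumes "j \<in> {1..n}"
  shows "(\<Sum>k\<in>{1..n}. of_int (epsw j k) * f k) = (f j :: complex)"
proof -
  have "(\<Sum>k\<in>{1..n}. of_int (epsw j k) * f k) = (\<Sum>k\<in>{1..n}. if k = j then f k else 0)"
    by (intro sum.cong) (auto simp: epsw_def)
  then show ?thesis using assms by simp
qed


section \<open>Counting roots\<close>

definition root1 :: "nat \<Rightarrow> nat \<Rightarrow> int \<Rightarrow> wt" where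
  "root1 j k \<sigma> = (\<lambda>i. epsw j i + \<sigma> * epsw k i)"

lemma rootsg1_root1:
  "rootsg1 n = {root1 j k \<sigma> | j k \<sigma>. 1 \<le> j \<and> j \<le> n-2 \<and> (k = n-1 \<or> k = n) \<and> \<sigma> \<in> {1,-1}}"
  unfolding rootsg1_def root1_def ..

lemma rootsD_le_1:
  assumes "w \<in> rootsD n"
  shows "\<bar>w i\<bar> \<le> 1"
  using assms unfolding rootsD_def epsw_def by auto

lemma rootsD_three:
  assumes "w \<in> rootsD n" "a \<noteq> b" "a \<noteq> c" "b \<noteq> c"
  shows "w a = 0 \<or> w b = 0 \<or> w c = 0"
  using assms unfolding rootsD_def epsw_def by (auto split: if_splits)

lemma rootsD_I:
  assumes "1 \<le> j" "j < k" "k \<le> n" "\<sigma> \<in> {1,-1}" "\<tau> \<in> {1,-1}" "\<And>i. w i = \<sigma> * epsw j i + \<tau> * epsw k i"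
  shows "w \<in> rootsD n"
proof -
  have "w = (\<lambda>i. \<sigma> * epsw j i + \<tau> * epsw k i)" using assms(6) by blast
  then show ?thesis unfolding rootsD_def using assms(1-5) by blast
qed

text \<open>The weight is 2 eps_1. No root has a coefficient 2, so \<open>\<alpha>\<close> must
  involve eps_1; its other index and its sign are then free.\<close>

lemma card_Delta_double:
  assumes n: "5 \<le> n"
  shows "card (Delta_nu n (\<lambda>i. mu n i + (epsw 1 i - epsw (n-1) i))) = 4"
proof -
  let ?nu = "\<lambda>i. mu n i + (epsw 1 i - epsw (n-1) i)"
  let ?A = "{root1 1 (n-1) 1, root1 1 (n-1) (-1), root1 1 n 1, root1 1 n (-1)}"
  have "Delta_nu n ?nu = ?A"
  proof (intro equalityI subsetI)
    fix \<alpha> assume "\<alpha> \<in> Delta_nu n ?nu"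
    then obtain j k \<sigma> where a: "\<alpha> = root1 j k \<sigma>" "1 \<le> j" "j \<le> n-2" "k = n-1 \<or> k = n" "\<sigma> \<in> {1,-1}"
      and r: "(\<lambda>i. ?nu i - \<alpha> i) \<in> rootsD n"
      unfolding Delta_nu_def rootsg1_root1 by blast
    have "j = 1"
    proof (rule ccontr)
      assume "j \<noteq> 1"
      then have "?nu 1 - \<alpha> 1 = 2" using a n by (auto simp: root1_def epsw_def mu_def)
      then show False using rootsD_le_1[OF r, of 1] by simp
    qed
    then show "\<alpha> \<in> ?A" using a by blast
  next
    fix \<alpha> assume "\<alpha> \<in> ?A"
    then obtain k \<sigma> where a: "\<alpha> = root1 1 k \<sigma>" "k = n-1 \<or> k = n" "\<sigma> \<in> {1,-1}" by blast
    have "(\<lambda>i. ?nu i - \<alpha> i) \<in> rootsD n"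
      using a n by (intro rootsD_I[of 1 k n 1 "-\<sigma>"]) (auto simp: root1_def mu_def)
    moreover have "1 \<le> n - 2" using n by simp
    ultimately show "\<alpha> \<in> Delta_nu n ?nu" unfolding Delta_nu_def rootsg1_root1 using a by blast
  qed
  moreover have "distinct [root1 1 (n-1) 1, root1 1 (n-1) (-1), root1 1 n 1, root1 1 n (-1)]"
    using n by (auto simp: root1_def epsw_def fun_eq_iff)
  then have "card ?A = 4" using distinct_card by fastforce
  ultimately show ?thesis by simp
qed

text \<open>The weight has four coordinates of absolute value 1, and a root has two. So
  \<open>\<alpha>\<close> has to cancel one of the first two coordinates and one of the last two,
  with matching sign: a wrong sign would leave a coefficient of absolute value 2.\<close>

lemma card_Delta_four:
  assumes n: "5 \<le> n" and t: "\<tau> \<in> {1,-1}"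
  shows "card (Delta_nu n (\<lambda>i. mu n i + (epsw 2 i + \<tau> * epsw n i))) = 4"
proof -
  let ?nu = "\<lambda>i. mu n i + (epsw 2 i + \<tau> * epsw n i)"
  let ?A = "{root1 1 (n-1) 1, root1 2 (n-1) 1, root1 1 n \<tau>, root1 2 n \<tau>}"
  have "Delta_nu n ?nu = ?A"
  proof (intro equalityI subsetI)
    fix \<alpha> assume "\<alpha> \<in> Delta_nu n ?nu"
    then obtain j k \<sigma> where a: "\<alpha> = root1 j k \<sigma>" "1 \<le> j" "j \<le> n-2" "k = n-1 \<or> k = n" "\<sigma> \<in> {1,-1}"
      and r: "(\<lambda>i. ?nu i - \<alpha> i) \<in> rootsD n"
      unfolding Delta_nu_def rootsg1_root1 by blast
    have ne: "(1::nat) \<noteq> 2" "1 \<noteq> n" "1 \<noteq> n - 1" "2 \<noteq> n" "2 \<noteq> n - 1" "n - 1 \<noteq> n" using n by auto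
    have v: "?nu (n-1) = 1" "?nu n = \<tau>" "?nu 1 = 1" "?nu 2 = 1"
      using n by (auto simp: mu_def epsw_def)
    have j: "j \<noteq> n - 1" "j \<noteq> n" using a n by auto
    have s: "(k = n - 1 \<longrightarrow> \<sigma> = 1) \<and> (k = n \<longrightarrow> \<sigma> = \<tau>)"
      using rootsD_le_1[OF r, of "n-1"] rootsD_le_1[OF r, of n] v a(4,5) t j ne
      by (auto simp: a(1) root1_def epsw_def)
    have "j = 1 \<or> j = 2"
    proof (rule ccontr)
      assume "\<not> (j = 1 \<or> j = 2)"
      then have 12: "?nu 1 - \<alpha> 1 \<noteq> 0" "?nu 2 - \<alpha> 2 \<noteq> 0"
        unfolding v using a(4) ne by (auto simp: a(1) root1_def epsw_def)
      show False
      proof (cases "k = n")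
        case True
        then have "?nu (n-1) - \<alpha> (n-1) \<noteq> 0" unfolding v using ne j by (auto simp: a(1) root1_def epsw_def)
        then show False using rootsD_three[OF r, of 1 2 "n-1"] 12 ne by blast
      next
        case False
        then have "?nu n - \<alpha> n \<noteq> 0" unfolding v using ne j t by (auto simp: a(1) root1_def epsw_def)
        then show False using rootsD_three[OF r, of 1 2 n] 12 ne by blast
      qed
    qed
    then show "\<alpha> \<in> ?A" using a(1,4) s by blast
  next
    fix \<alpha> assume "\<alpha> \<in> ?A"
    then obtain j j' :: nat where a: "\<alpha> = root1 j (n-1) 1 \<or> \<alpha> = root1 j n \<tau>" and j: "j = 1 \<and> j' = 2 \<or> j = 2 \<and> j' = 1"
      by blast
    have "(\<lambda>i. ?nu i - \<alpha> i) \<in> rootsD n"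
      using a
    proof
      assume "\<alpha> = root1 j (n-1) 1"
      then show ?thesis using j n t by (intro rootsD_I[of j' n n 1 \<tau>]) (auto simp: root1_def mu_def)
    next
      assume "\<alpha> = root1 j n \<tau>"
      then show ?thesis using j n t by (intro rootsD_I[of j' "n-1" n 1 1]) (auto simp: root1_def mu_def)
    qed
    moreover have "1 \<le> j" "j \<le> n - 2" using j n by auto
    ultimately show "\<alpha> \<in> Delta_nu n ?nu" unfolding Delta_nu_def rootsg1_root1 using a t by blast
  qed
  moreover have "distinct [root1 1 (n-1) 1, root1 2 (n-1) 1, root1 1 n \<tau>, root1 2 n \<tau>]"
  proof -
    have ne: "(1::nat) \<noteq> 2" "1 \<noteq> n" "1 \<noteq> n - 1" "2 \<noteq> n" "2 \<noteq> n - 1" "n - 1 \<noteq> n" using n by auto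
    have d1: "root1 1 k \<sigma> \<noteq> root1 2 k' \<sigma>'" if "k = n-1 \<or> k = n" "k' = n-1 \<or> k' = n" for k k' \<sigma> \<sigma>'
    proof
      assume "root1 1 k \<sigma> = root1 2 k' \<sigma>'"
      from fun_cong[OF this, of 1] show False using that ne by (auto simp: root1_def epsw_def)
    qed
    have d2: "root1 j (n-1) 1 \<noteq> root1 j n \<tau>" if "j = 1 \<or> j = 2" for j
    proof
      assume "root1 j (n-1) 1 = root1 j n \<tau>"
      from fun_cong[OF this, of "n-1"] show False using that ne by (auto simp: root1_def epsw_def)
    qed
    have "root1 2 (n-1) 1 \<noteq> root1 1 n \<tau>" using d1[of n "n-1" \<tau> 1] by auto
    then show ?thesis using d1 d2 by simp
  qed
  then have "card ?A = 4" using distinct_card by fastforce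
  ultimately show ?thesis by simp
qed

section \<open>Evaluation of the weights and the equivalence with s = 1\<close>

lemma evalw_four:
  assumes n: "5 \<le> n"
  shows "evalw n (\<lambda>i. mu n i + (epsw 2 i + \<tau> * epsw n i)) H
    = H 0 0 + H 1 1 + H (n-2) (n-2) + of_int \<tau> * H (n-1) (n-1)"
proof -
  let ?f = "\<lambda>k. H (k-1) (k-1)"
  have "evalw n (\<lambda>i. mu n i + (epsw 2 i + \<tau> * epsw n i)) H =
    (\<Sum>k\<in>{1..n}. of_int (epsw 1 k) * ?f k) + (\<Sum>k\<in>{1..n}. of_int (epsw (n-1) k) * ?f k)
    + (\<Sum>k\<in>{1..n}. of_int (epsw 2 k) * ?f k) + of_int \<tau> * (\<Sum>k\<in>{1..n}. of_int (epsw n k) * ?f k)"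
    unfolding evalw_def mu_def by (simp add: sum.distrib sum_distrib_left algebra_simps)
  also have "\<dots> = ?f 1 + ?f (n-1) + ?f 2 + of_int \<tau> * ?f n"
    using n by (subst (1 2 3 4) sum_epsw) auto
  finally show ?thesis using n by (simp add: numeral_2_eq_2)
qed

lemma evalw_double:
  assumes n: "5 \<le> n"
  shows "evalw n (\<lambda>i. mu n i + (epsw 1 i - epsw (n-1) i)) H = 2 * H 0 0"
proof -
  have "evalw n (\<lambda>i. mu n i + (epsw 1 i - epsw (n-1) i)) H =
    2 * (\<Sum>k\<in>{1..n}. of_int (epsw 1 k) * H (k-1) (k-1))"
    unfolding evalw_def mu_def by (simp add: sum.distrib sum_distrib_left algebra_simps)
  then show ?thesis using sum_epsw[of 1 n "\<lambda>k. H (k-1) (k-1)"] n by simp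
qed

lemma conf_inv_double:
  assumes n: "5 \<le> n"
  shows "conf_inv n (\<lambda>i. mu n i + (epsw 1 i - epsw (n-1) i)) s \<longleftrightarrow> s = 1"
proof
  assume "conf_inv n (\<lambda>i. mu n i + (epsw 1 i - epsw (n-1) i)) s"
  moreover have "(\<lambda>a b c d. \<Sum>k<n-2. kron (Mb n k 0) (Mb n (n+k) 0) a b c d)
      \<in> Wdual n (\<lambda>i. mu n i + (epsw 1 i - epsw (n-1) i))"
    by (intro Wdual.gen lowest_sum n evalw_double)
  ultimately show "s = 1"
    using n by (rule_tac conf_inv_unique[OF _ _ _ _ _ _ _ polarB_lowest_sum[OF n]]) (auto simp: Qs_def)
next
  assume "s = 1"
  then show "conf_inv n (\<lambda>i. mu n i + (epsw 1 i - epsw (n-1) i)) s" using conf_inv_one n by simp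
qed

lemma conf_inv_four:
  assumes n: "5 \<le> n" and t: "\<tau> \<in> {1,-1}"
  shows "conf_inv n (\<lambda>i. mu n i + (epsw 2 i + \<tau> * epsw n i)) s \<longleftrightarrow> s = 1"
proof
  assume inv: "conf_inv n (\<lambda>i. mu n i + (epsw 2 i + \<tau> * epsw n i)) s"
  \<comment> \<open>The weight of the lowest vector must contain \<open>- \<tau>\<close> times
    eps_n, so the row index is \<open>n - 1\<close> or its conjugate according to the sign.\<close>
  define c where "c = (if \<tau> = 1 then n + (n - 1) else n - 1)"
  have c: "c = n - 1 \<or> c = n + (n - 1)" by (simp add: c_def)
  have "kron (Mb n c (n-2)) (Mb n (n+1) 0) \<in> Wdual n (\<lambda>i. mu n i + (epsw 2 i + \<tau> * epsw n i))"
  proof (intro Wdual.gen lowest_kron[OF n c])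
    fix H assume "H \<in> cartan n"
    then have "H \<in> so n" unfolding cartan_def by simp
    from so_cj[OF this, of "n-1" "n-1"] have "H (n+(n-1)) (n+(n-1)) = - H (n-1) (n-1)"
      using n by (simp add: cj_def add.commute)
    then show "evalw n (\<lambda>i. mu n i + (epsw 2 i + \<tau> * epsw n i)) H = H 0 0 + H 1 1 + H (n-2) (n-2) - H c c"
      using t unfolding evalw_four[OF n] c_def by auto
  qed
  then show "s = 1"
    using n c by (intro conf_inv_unique[OF _ inv _ _ _ _ _ polarB_lowest_kron[OF n c]]) (auto simp: Qs_def)
next
  assume "s = 1"
  then show "conf_inv n (\<lambda>i. mu n i + (epsw 2 i + \<tau> * epsw n i)) s" using conf_inv_one n by simp
qed

theorem theorem3p1:
  fixes n :: nat and s :: complex and eps :: wt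
  assumes "5 \<le> n"
    and "eps \<in> {(\<lambda>i. epsw 1 i - epsw (n-1) i), (\<lambda>i. epsw 2 i + epsw n i),
                (\<lambda>i. epsw 2 i - epsw n i)}"
  shows "conf_inv n (\<lambda>i. mu n i + eps i) s \<longleftrightarrow>
         s = of_nat (card (Delta_nu n (\<lambda>i. mu n i + eps i))) / 2 - 1"
proof -
  \<comment> \<open>The value 4 / 2 - 1 is 1, so both sides reduce to \<open>s = 1\<close> for each
    choice of \<open>eps\<close>.\<close>
  have "card (Delta_nu n (\<lambda>i. mu n i + eps i)) = 4 \<and> (conf_inv n (\<lambda>i. mu n i + eps i) s \<longleftrightarrow> s = 1)"
    using assms(2) card_Delta_double[OF assms(1)] conf_inv_double[OF assms(1)]
      card_Delta_four[OF assms(1), of 1] conf_inv_four[OF assms(1), of 1]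
      card_Delta_four[OF assms(1), of "-1"] conf_inv_four[OF assms(1), of "-1"]
    by auto
  then show ?thesis by simp
qed

end
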